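(* There exist a positive integer $M$ and distributions of $\xi^{(r)}_1$, $\xi^{(b)}_1$, $N_r$ and $N_b$ within the class of models described in the context, with $$\mathbb{E}[(\xi^{(r)}_1)^2]>3\,\mathbb{E}[(\xi^{(b)}_1)^2]\quad\text{and}\quad \min\big\{\mathbb{P}(\xi^{(r)}_1\notin\{-1,0,1\}),\,\mathbb{P}(\xi^{(b)}_1\notin\{-1,0,1\})\big\}>0,$$ such that $$\lim_{n\uparrow\infty}\frac{M^{(r)}_n}{n}=\lim_{n\uparrow\infty}\frac{M^{(b)}_n}{n}\quad\text{almost surely},$$ but $$\mathbb{P}(B\text{ is infinite})=\mathbb{P}(R\text{ is finite})=1.$$
   Context: Class of models: let $N_r,N_b$ be independent random variables with values in $\{1,2,\dots\}$ with $1<\mathbb{E}[N_r]<\infty$ and $1<\mathbb{E}[N_b]<\infty$. Let $(\xi^{(r)}_j)_{j\ge1}$ and $(\xi^{(b)}_j)_{j\ge1}$ each be a family of i.i.d. symmetrically distributed random variables with values in $\{-M,\dots,M\}$, for a positive integer $M$; the two families are mutually independent and independent of $N_r,N_b$, and $\min\{\mathbb{P}(\xi^{(r)}_1=1),\mathbb{P}(\xi^{(b)}_1=1)\}>0$. Define the offspring point processes $\Xi_r=\sum_{j=1}^{N_r}\boldsymbol{\delta}_{\xi^{(r)}_j}$ and $\Xi_b=\sum_{j=1}^{N_b}\boldsymbol{\delta}_{\xi^{(b)}_j}$. Let $X^{(r)}$ and $X^{(b)}$ be independent time-discrete branching random walks on $\mathbb{Z}$ driven by $\Xi_r$ and $\Xi_b$,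 started from a single particle at $0$ (red) and a single particle at $1$ (blue), respectively: at each time step every particle, independently of all others, is replaced by offspring whose displacements from the parent's position form an independent copy of the corresponding offspring point process. $M^{(r)}_n$ and $M^{(b)}_n$ denote the positions of the right-most particles of $X^{(r)}$ and $X^{(b)}$ at time $n$. Coloring: $R\subseteq\mathbb{Z}$ and $B\subseteq\mathbb{Z}$ are the sets of sites first visited by $X^{(r)}$ and by $X^{(b)}$, respectively, with an arbitrary tie-breaking rule if a site is visited for the first time simultaneously by both; the result does not depend on the tie-breaking rule. *)

theory Defs
  imports "HOL-Probability.Probability"
begin

text \<open>
  Particles carry labels in \<^typ>\<open>nat list\<close>: the ancestor is \<^term>\<open>[]\<close>, and \<open>j # u\<close> is the
  child number \<open>j\<close> of \<open>u\<close>.  A genealogy assigns to every potential particle \<open>u\<close> a pair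
  \<open>(N, \<xi>)\<close> of an offspring number and a sequence of displacements.  Its offspring point process is
  the sum of the unit masses at \<open>\<xi> j\<close> over \<open>j < N\<close>, so the families are indexed from 0.
\<close>

type_synonym genealogy = "nat list \<Rightarrow> nat \<times> (nat \<Rightarrow> int)"

definition offspring_space :: "nat pmf \<Rightarrow> int pmf \<Rightarrow> (nat \<times> (nat \<Rightarrow> int)) measure" where
  "offspring_space \<nu> \<mu> = measure_pmf \<nu> \<Otimes>\<^sub>M (\<Pi>\<^sub>M j\<in>UNIV. measure_pmf \<mu>)"

definition brw_space :: "nat pmf \<Rightarrow> int pmf \<Rightarrow> genealogy measure" where
  "brw_space \<nu> \<mu> = (\<Pi>\<^sub>M u\<in>UNIV. offspring_space \<nu> \<mu>)"

primrec particles :: "genealogy \<Rightarrow> nat \<Rightarrow> nat list set" where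
  "particles g 0 = {[]}"
| "particles g (Suc n) = {j # u | j u. u \<in> particles g n \<and> j < fst (g u)}"

primrec position :: "genealogy \<Rightarrow> int \<Rightarrow> nat list \<Rightarrow> int" where
  "position g x [] = x"
| "position g x (j # u) = position g x u + snd (g u) j"

definition occupied :: "genealogy \<Rightarrow> int \<Rightarrow> nat \<Rightarrow> int set" where
  "occupied g x n = position g x ` particles g n"

definition rightmost :: "genealogy \<Rightarrow> int \<Rightarrow> nat \<Rightarrow> int" where
  "rightmost g x n = Max (occupied g x n)"

text \<open>The value is \<open>\<infinity>\<close> if the site \<open>y\<close> is never visited.\<close>

definition first_visit :: "genealogy \<Rightarrow> int \<Rightarrow> int \<Rightarrow> enat" where
  "first_visit g x y = (INF n \<in> {n. y \<in> occupied g x n}. enat n)"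

datatype colour = Red | Blue

text \<open>A sample point of the two-colour model consists of the red and the blue genealogy.\<close>

type_synonym sample = "genealogy \<times> genealogy"

definition two_colour_space ::
    "nat pmf \<Rightarrow> int pmf \<Rightarrow> nat pmf \<Rightarrow> int pmf \<Rightarrow> sample measure" where
  "two_colour_space \<nu>r \<mu>r \<nu>b \<mu>b = brw_space \<nu>r \<mu>r \<Otimes>\<^sub>M brw_space \<nu>b \<mu>b"

definition red_max :: "sample \<Rightarrow> nat \<Rightarrow> int" where
  "red_max \<omega> n = rightmost (fst \<omega>) 0 n"

definition blue_max :: "sample \<Rightarrow> nat \<Rightarrow> int" where
  "blue_max \<omega> n = rightmost (snd \<omega>) 1 n"

definition red_time :: "sample \<Rightarrow> int \<Rightarrow> enat" where
  "red_time \<omega> y = first_visit (fst \<omega>) 0 y"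

definition blue_time :: "sample \<Rightarrow> int \<Rightarrow> enat" where
  "blue_time \<omega> y = first_visit (snd \<omega>) 1 y"

text \<open>
  A tie-breaking rule gives the colour of each site that both walks first visit at the same
  (finite) time.  It may depend on the whole sample point.  Sites that are never visited have
  no colour.
\<close>

type_synonym tie_rule = "sample \<Rightarrow> int \<Rightarrow> colour"

definition red_sites :: "tie_rule \<Rightarrow> sample \<Rightarrow> int set" where
  "red_sites tie \<omega> = {y. red_time \<omega> y < blue_time \<omega> y \<or>
     (red_time \<omega> y = blue_time \<omega> y \<and> red_time \<omega> y < \<infinity> \<and> tie \<omega> y = Red)}"

definition blue_sites :: "tie_rule \<Rightarrow> sample \<Rightarrow> int set" where
  "blue_sites tie \<omega> = {y. blue_time \<omega> y < red_time \<omega> y \<or>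
     (red_time \<omega> y = blue_time \<omega> y \<and> red_time \<omega> y < \<infinity> \<and> tie \<omega> y = Blue)}"

definition offspring_number_law :: "nat pmf \<Rightarrow> bool" where
  "offspring_number_law \<nu> \<longleftrightarrow> set_pmf \<nu> \<subseteq> {1..} \<and> integrable (measure_pmf \<nu>) real \<and>
     1 < measure_pmf.expectation \<nu> real"

definition displacement_law :: "nat \<Rightarrow> int pmf \<Rightarrow> bool" where
  "displacement_law M \<mu> \<longleftrightarrow> set_pmf \<mu> \<subseteq> {- int M..int M} \<and> map_pmf uminus \<mu> = \<mu>"

definition model_class ::
    "nat \<Rightarrow> nat pmf \<Rightarrow> int pmf \<Rightarrow> nat pmf \<Rightarrow> int pmf \<Rightarrow> bool" where
  "model_class M \<nu>r \<mu>r \<nu>b \<mu>b \<longleftrightarrow> 0 < M \<and>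
     offspring_number_law \<nu>r \<and> offspring_number_law \<nu>b \<and>
     displacement_law M \<mu>r \<and> displacement_law M \<mu>b \<and>
     0 < min (pmf \<mu>r 1) (pmf \<mu>b 1)"

end

theory Submission
  imports Defs
begin

text \<open>
  Both walks have steps of length at most 2, so no particle moves faster than speed 2.  Call a line of
  descent full-speed if all its steps are \<open>2\<close> (or all are \<open>-2\<close>, for the left side).
  The full-speed lines starting in a given particle form a Galton-Watson process, and the example
  plays its critical phase against its supercritical phase.

  Red particles have 4 children with displacement uniform on \<open>{-2, -1, 1, 2}\<close>.  The mean number of
  full-speed children is 1, so every full-speed line dies out (\<open>critical_steady_dies\<close>).  The lag of the
  red front behind \<open>2n\<close> therefore tends to infinity (\<open>occupied_far_behind\<close>).  The speed of the front is
  still 2: as soon as a line may take a short step \<open>1\<close> once in every \<open>k + 1\<close> generations, the process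
  of such lines becomes supercritical (\<open>critical_sparing_survives\<close>), which gives speed at least
  \<open>2 - 1 / (k + 1)\<close> for every \<open>k\<close>.

  Blue particles have 34 children, each of which takes the step \<open>2\<close> with probability 1/17 and mostly
  stays where it is.  The mean number of full-speed children is 2, so full-speed lines survive with
  positive probability (\<open>supercritical_steady_survives\<close>), and among the many independent trials that
  the tree offers some line survives almost surely (\<open>AE_some_branch\<close>).  Hence the blue front has speed 2
  with bounded lag.  Two surviving lines of different parity visit all far sites, and red, with its
  unbounded lag, comes later there (\<open>sites_beyond_first_blue\<close>).  The same holds on the left side.  So red
  is first in finitely many sites only, although its variance \<open>5/2\<close> is more than three times the
  blue variance \<open>10/17\<close>.
\<close>

section \<open>Displacements on the genealogical tree\<close>

text \<open>
  The randomness of a walk is a family of independent displacements, one for each edge of the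
  genealogical tree.  The edge from \<open>u\<close> to its child \<open>j # u\<close> is named by the child.  The root has no
  edge and gets the value 0, which respects every bound on the length of steps.
\<close>

definition edge_step :: "genealogy \<Rightarrow> nat list \<Rightarrow> int" where
  "edge_step g w = (case w of [] \<Rightarrow> 0 | j # u \<Rightarrow> snd (g u) j)"

text \<open>
  A planted tree: the descendants of \<open>w\<close> together with the edge that leads to \<open>w\<close>, which is stored
  at \<open>[]\<close>.  Including that edge makes all planted trees with \<open>w \<noteq> []\<close> have the same i.i.d. law,
  and makes the recursion over generations consist of independent pieces only.
\<close>

definition branch :: "genealogy \<Rightarrow> nat list \<Rightarrow> nat list \<Rightarrow> int" where
  "branch g w = (\<lambda>v. edge_step g (v @ w))"

lemma branch_Nil: "branch g w [] = edge_step g w"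
  by (simp add: branch_def)

definition subtree :: "nat \<Rightarrow> (nat list \<Rightarrow> int) \<Rightarrow> nat list \<Rightarrow> int" where
  "subtree j \<eta> = (\<lambda>v. \<eta> (v @ [j]))"

definition tree_space :: "int pmf \<Rightarrow> (nat list \<Rightarrow> int) measure" where
  "tree_space \<mu> = (\<Pi>\<^sub>M v\<in>UNIV. measure_pmf \<mu>)"

lemma subtree_branch: "subtree j (branch g w) = branch g (j # w)"
  by (simp add: subtree_def branch_def)

lemma prob_space_tree_space: "prob_space (tree_space \<mu>)"
  unfolding tree_space_def by (intro prob_space_PiM prob_space_measure_pmf)

lemma prob_space_offspring_space: "prob_space (offspring_space \<nu> \<mu>)"
  unfolding offspring_space_def
  by (intro prob_space_pair prob_space_PiM prob_space_measure_pmf)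

lemma prob_space_brw_space: "prob_space (brw_space \<nu> \<mu>)"
  unfolding brw_space_def by (intro prob_space_PiM prob_space_offspring_space)

lemma space_tree_space [simp]: "space (tree_space \<mu>) = UNIV"
  by (auto simp: tree_space_def space_PiM)

lemma UNIV_sets_tree_space [simp]: "UNIV \<in> sets (tree_space \<mu>)"
  using sets.top[of "tree_space \<mu>"] by simp

lemma space_offspring_space [simp]: "space (offspring_space \<nu> \<mu>) = UNIV"
  by (auto simp: offspring_space_def space_PiM space_pair_measure)

lemma space_brw_space [simp]: "space (brw_space \<nu> \<mu>) = UNIV"
  by (auto simp: brw_space_def space_PiM)

lemma measurable_coordinate [measurable]:
  "(\<lambda>\<eta>. \<eta> v) \<in> measurable (tree_space \<mu>) (measure_pmf \<mu>)"
  unfolding tree_space_def by (rule measurable_component_singleton) simp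

lemma measurable_subtree [measurable]:
  "subtree j \<in> measurable (tree_space \<mu>) (tree_space \<mu>)"
proof -
  have "(\<lambda>\<eta>. \<lambda>v\<in>UNIV. \<eta> (v @ [j])) \<in> measurable (tree_space \<mu>) (tree_space \<mu>)"
    unfolding tree_space_def by (intro measurable_restrict measurable_component_singleton) simp
  then show ?thesis by (simp add: subtree_def[abs_def] restrict_def)
qed

text \<open>
  A planted tree is self-similar, since relabelling the coordinates of an i.i.d. family by an
  injection does not change its law.
\<close>

lemma distr_subtree: "distr (tree_space \<mu>) (tree_space \<mu>) (subtree j) = tree_space \<mu>"
proof -
  have "inj (\<lambda>v. v @ [j])" by (auto intro: injI)
  from distr_PiM_reindex[of UNIV "\<lambda>_. measure_pmf \<mu>", OF prob_space_measure_pmf this]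
  show ?thesis by (simp add: tree_space_def subtree_def[abs_def] restrict_def)
qed

lemma measurable_edge_step [measurable]:
  "(\<lambda>g. edge_step g w) \<in> measurable (brw_space \<nu> \<mu>) (measure_pmf \<mu>)"
proof (cases w)
  case (Cons j u)
  have "(\<lambda>g. snd (g u) j) \<in> measurable (brw_space \<nu> \<mu>) (measure_pmf \<mu>)"
    unfolding brw_space_def offspring_space_def by measurable
  then show ?thesis by (simp add: edge_step_def Cons)
qed (simp add: edge_step_def)

lemma measurable_branch [measurable]:
  "(\<lambda>g. branch g w) \<in> measurable (brw_space \<nu> \<mu>) (tree_space \<mu>)"
proof -
  have "(\<lambda>g. \<lambda>v\<in>UNIV. edge_step g (v @ w)) \<in> measurable (brw_space \<nu> \<mu>) (tree_space \<mu>)"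
    unfolding tree_space_def by (intro measurable_restrict measurable_edge_step)
  then show ?thesis by (simp add: branch_def[abs_def] restrict_def)
qed

lemma emeasure_displacement_box:
  fixes F :: "nat \<Rightarrow> int set"
  assumes "finite J"
  shows "emeasure (offspring_space \<nu> \<mu>) {x. \<forall>j\<in>J. snd x j \<in> F j} = (\<Prod>j\<in>J. emeasure (measure_pmf \<mu>) (F j))"
proof -
  let ?P = "\<Pi>\<^sub>M j\<in>(UNIV::nat set). measure_pmf \<mu>"
  interpret P: product_prob_space "\<lambda>_::nat. measure_pmf \<mu>" UNIV
    by standard
  have [measurable]: "{f. \<forall>j\<in>J. f j \<in> F j} \<in> sets ?P"
  proof -
    have "{f \<in> space ?P. \<forall>j\<in>J. f j \<in> F j} \<in> sets ?P"
      using assms by (intro sets.sets_Collect_finite_All) auto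
    then show ?thesis by (simp add: space_PiM)
  qed
  have "{x. \<forall>j\<in>J. snd x j \<in> F j} = (UNIV :: nat set) \<times> {f. \<forall>j\<in>J. f j \<in> F j}" by auto
  then have "emeasure (offspring_space \<nu> \<mu>) {x. \<forall>j\<in>J. snd x j \<in> F j}
      = emeasure (measure_pmf \<nu>) UNIV * emeasure ?P {f. \<forall>j\<in>J. f j \<in> F j}"
    unfolding offspring_space_def by (simp only: P.emeasure_pair_measure_Times sets_measure_pmf UNIV_I, intro P.emeasure_pair_measure_Times) auto
  also have "\<dots> = emeasure ?P {f \<in> space ?P. \<forall>j\<in>J. f j \<in> F j}"
    by (simp add: space_PiM measure_pmf.emeasure_space_1[simplified])
  also have "\<dots> = (\<Prod>j\<in>J. emeasure (measure_pmf \<mu>) (F j))"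
    using assms by (intro P.emeasure_PiM_Collect) auto
  finally show ?thesis .
qed

text \<open>
  Displacements are independent in two layers: across particles, and across the children of one
  particle.  Grouping the edges by their parent \<open>tl w\<close> merges the two layers into one.
\<close>

lemma emeasure_edge_box:
  fixes F :: "nat list \<Rightarrow> int set"
  assumes "finite J" "[] \<notin> J"
  shows "emeasure (brw_space \<nu> \<mu>) {g. \<forall>w\<in>J. edge_step g w \<in> F w} = (\<Prod>w\<in>J. emeasure (measure_pmf \<mu>) (F w))"
proof -
  interpret P: product_prob_space "\<lambda>_::nat list. offspring_space \<nu> \<mu>" UNIV
    by (intro product_prob_space.intro product_prob_space_axioms.intro product_sigma_finite.intro
          prob_space_offspring_space prob_space_imp_sigma_finite)
  define C where "C u = {j. j # u \<in> J}" for u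
  have C: "finite (C u)" for u
    using finite_vimageI[OF assms(1), of "\<lambda>j. j # u"] by (simp add: C_def vimage_def inj_def)
  define B where "B u = {x :: nat \<times> (nat \<Rightarrow> int). \<forall>j\<in>C u. snd x j \<in> F (j # u)}" for u
  have B: "B u \<in> sets (offspring_space \<nu> \<mu>)" for u
  proof -
    have "{x \<in> space (offspring_space \<nu> \<mu>). \<forall>j\<in>C u. snd x j \<in> F (j # u)} \<in> sets (offspring_space \<nu> \<mu>)"
      using C by (intro sets.sets_Collect_finite_All) (auto simp: offspring_space_def)
    then show ?thesis by (simp add: B_def)
  qed
  have J: "J = (\<lambda>(u, j). j # u) ` (SIGMA u : tl ` J. C u)"
  proof safe
    fix w assume "w \<in> J"
    moreover from this have "w = hd w # tl w" using assms by (cases w) auto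
    ultimately show "w \<in> (\<lambda>(u, j). j # u) ` (SIGMA u : tl ` J. C u)"
      by (intro image_eqI[of _ _ "(tl w, hd w)"]) (auto simp: C_def)
  qed (auto simp: C_def)
  have "{g. \<forall>w\<in>J. edge_step g w \<in> F w} = {g \<in> space (brw_space \<nu> \<mu>). \<forall>u\<in>tl ` J. g u \<in> B u}"
    by (subst J) (auto simp: B_def edge_step_def)
  also have "emeasure (brw_space \<nu> \<mu>) \<dots> = (\<Prod>u\<in>tl ` J. emeasure (offspring_space \<nu> \<mu>) (B u))"
    unfolding brw_space_def using assms(1) B by (intro P.emeasure_PiM_Collect) auto
  also have "\<dots> = (\<Prod>u\<in>tl ` J. \<Prod>j\<in>C u. emeasure (measure_pmf \<mu>) (F (j # u)))"
    unfolding B_def using C by (intro prod.cong refl emeasure_displacement_box)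
  also have "\<dots> = (\<Prod>(u, j)\<in>(SIGMA u : tl ` J. C u). emeasure (measure_pmf \<mu>) (F (j # u)))"
    using C assms(1) by (intro prod.Sigma) auto
  also have "\<dots> = (\<Prod>w\<in>J. emeasure (measure_pmf \<mu>) (F w))"
    by (subst (2) J, subst prod.reindex) (auto simp: inj_on_def case_prod_beta intro!: prod.cong)
  finally show ?thesis .
qed

lemma distr_branch:
  assumes "w \<noteq> []"
  shows "distr (brw_space \<nu> \<mu>) (tree_space \<mu>) (\<lambda>g. branch g w) = tree_space \<mu>"
proof (rule measure_eqI_PiM_infinite)
  let ?M = "\<lambda>_::nat list. measure_pmf \<mu>"
  fix J :: "nat list set" and F :: "nat list \<Rightarrow> int set"
  assume J: "finite J"
  define J' where "J' = (\<lambda>v. v @ w) ` J"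
  define F' where "F' x = F (take (length x - length w) x)" for x
  have "prod_emb UNIV ?M J (Pi\<^sub>E J F) \<in> sets (tree_space \<mu>)"
    unfolding tree_space_def using J by (intro sets_PiM_I) auto
  then have "emeasure (distr (brw_space \<nu> \<mu>) (tree_space \<mu>) (\<lambda>g. branch g w)) (prod_emb UNIV ?M J (Pi\<^sub>E J F))
    = emeasure (brw_space \<nu> \<mu>) {g. \<forall>x\<in>J'. edge_step g x \<in> F' x}"
    by (subst emeasure_distr)
       (auto simp: vimage_def prod_emb_def branch_def J'_def F'_def PiE_iff
        intro!: arg_cong[where f = "emeasure _"] measurable_branch[unfolded branch_def])
  also have "\<dots> = (\<Prod>x\<in>J'. emeasure (measure_pmf \<mu>) (F' x))"
    using J assms by (intro emeasure_edge_box) (auto simp: J'_def)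
  also have "\<dots> = (\<Prod>v\<in>J. emeasure (measure_pmf \<mu>) (F v))"
    unfolding J'_def by (subst prod.reindex) (auto simp: inj_on_def F'_def)
  also have "\<dots> = emeasure (tree_space \<mu>) (prod_emb UNIV ?M J (Pi\<^sub>E J F))"
    unfolding tree_space_def using J
    by (intro emeasure_PiM_emb[symmetric] prob_space_measure_pmf) auto
  finally show "emeasure (distr (brw_space \<nu> \<mu>) (tree_space \<mu>) (\<lambda>g. branch g w)) (prod_emb UNIV ?M J (Pi\<^sub>E J F))
    = emeasure (tree_space \<mu>) (prod_emb UNIV ?M J (Pi\<^sub>E J F))" .
next
  interpret B: prob_space "brw_space \<nu> \<mu>" by (rule prob_space_brw_space)
  show "finite_measure (distr (brw_space \<nu> \<mu>) (tree_space \<mu>) (\<lambda>g. branch g w))"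
    by (rule B.finite_measure_distr) measurable
qed (simp_all add: tree_space_def)

text \<open>
  This transfers every almost sure property of the i.i.d. tree to each planted tree of the walk.
\<close>

lemma AE_branch:
  assumes "w \<noteq> []" "AE \<eta> in tree_space \<mu>. P \<eta>"
  shows "AE g in brw_space \<nu> \<mu>. P (branch g w)"
  by (rule AE_distrD[OF measurable_branch, where P = P]) (unfold distr_branch[OF assms(1)], rule assms(2))

section \<open>The branching property\<close>

text \<open>
  The branching property: the edge of a planted tree and the planted trees of its children depend on
  disjoint sets of coordinates, hence are independent.
\<close>

lemma prob_root_children:
  assumes E: "\<And>j. j < K \<Longrightarrow> E j \<in> sets (tree_space \<mu>)"
  shows "measure (tree_space \<mu>) {\<eta>. \<eta> [] \<in> X \<and> (\<forall>j<K. subtree j \<eta> \<in> E j)} =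
     measure (measure_pmf \<mu>) X * (\<Prod>j<K. measure (tree_space \<mu>) (E j))"
proof -
  let ?T = "tree_space \<mu>" and ?M = "\<lambda>_::nat list. measure_pmf \<mu>"
  interpret T: prob_space ?T by (rule prob_space_tree_space)
  interpret P: product_prob_space ?M UNIV by standard
  have "T.indep_vars ?M (\<lambda>v \<eta>. \<eta> v) UNIV"
    by (subst T.indep_vars_iff_distr_eq_PiM)
       (auto simp: tree_space_def P.PiM_component restrict_def distr_id2)
  \<comment> \<open>The index \<open>None\<close> stands for the bottom edge, \<open>Some j\<close> for the planted tree of child \<open>j\<close>.\<close>
  define I :: "nat option \<Rightarrow> nat list set" where
    "I i = (case i of None \<Rightarrow> {[]} | Some j \<Rightarrow> range (\<lambda>v. v @ [j]))" for i
  have "T.indep_vars (\<lambda>i. PiM (I i) ?M) (\<lambda>i \<eta>. restrict (\<lambda>v. \<eta> v) (I i)) UNIV"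
    by (rule T.indep_vars_restrict) (fact, simp, auto simp: disjoint_family_on_def I_def split: option.splits)
  define A where "A i = (case i of None \<Rightarrow> {f \<in> space (PiM (I None) ?M). f [] \<in> X}
      | Some j \<Rightarrow> {f \<in> space (PiM (I (Some j)) ?M). (\<lambda>v. f (v @ [j])) \<in> E j})" for i
  have meas: "A i \<in> sets (PiM (I i) ?M)" if "i \<in> insert None (Some ` {..<K})" for i
  proof (cases i)
    case None
    have "(\<lambda>f. f []) \<in> measurable (PiM (I None) ?M) (measure_pmf \<mu>)"
      by (rule measurable_component_singleton) (simp add: I_def)
    from measurable_sets[OF this, of X] show ?thesis
      by (simp add: A_def None vimage_def Int_def conj_commute)
  next
    case (Some j)
    then have j: "j < K" using that by auto
    have "(\<lambda>f. \<lambda>v\<in>UNIV. f (v @ [j])) \<in> measurable (PiM (I (Some j)) ?M) ?T"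
      unfolding tree_space_def by (intro measurable_restrict measurable_component_singleton) (auto simp: I_def)
    from measurable_sets[OF this E[OF j]] show ?thesis
      by (simp add: A_def Some vimage_def Int_def conj_commute restrict_def)
  qed
  have vA: "(\<lambda>\<eta>. restrict (\<lambda>v. \<eta> v) (I i)) -` A i \<inter> space ?T =
      (case i of None \<Rightarrow> {\<eta>. \<eta> [] \<in> X} | Some j \<Rightarrow> {\<eta>. subtree j \<eta> \<in> E j})" for i
    by (auto simp: A_def I_def space_PiM subtree_def split: option.splits)
  have "T.prob (\<Inter>i\<in>insert None (Some ` {..<K}). (\<lambda>\<eta>. restrict (\<lambda>v. \<eta> v) (I i)) -` A i \<inter> space ?T)
     = (\<Prod>i\<in>insert None (Some ` {..<K}). T.prob ((\<lambda>\<eta>. restrict (\<lambda>v. \<eta> v) (I i)) -` A i \<inter> space ?T))"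
    by (rule T.indep_varsD[OF \<open>T.indep_vars (\<lambda>i. PiM (I i) ?M) _ UNIV\<close>]) (use meas in auto)
  also have "\<dots> = T.prob {\<eta>. \<eta> [] \<in> X} * (\<Prod>j<K. T.prob {\<eta>. subtree j \<eta> \<in> E j})"
    unfolding vA by (subst prod.insert) (auto simp: prod.reindex)
  also have "T.prob {\<eta>. \<eta> [] \<in> X} = measure (measure_pmf \<mu>) X"
  proof -
    have "distr ?T (measure_pmf \<mu>) (\<lambda>\<eta>. \<eta> []) = measure_pmf \<mu>"
      unfolding tree_space_def by (rule P.PiM_component) simp
    then have "measure (measure_pmf \<mu>) X = measure (distr ?T (measure_pmf \<mu>) (\<lambda>\<eta>. \<eta> [])) X"
      by simp
    also have "\<dots> = T.prob {\<eta>. \<eta> [] \<in> X}"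
      by (subst measure_distr[OF measurable_coordinate]) (auto simp: vimage_def)
    finally show ?thesis by simp
  qed
  also have "(\<Prod>j<K. T.prob {\<eta>. subtree j \<eta> \<in> E j}) = (\<Prod>j<K. T.prob (E j))"
  proof (rule prod.cong)
    fix j assume "j \<in> {..<K}"
    then have "measure (distr ?T ?T (subtree j)) (E j) = T.prob {\<eta>. subtree j \<eta> \<in> E j}"
      using E by (subst measure_distr) (auto simp: vimage_def)
    then show "T.prob {\<eta>. subtree j \<eta> \<in> E j} = T.prob (E j)" by (simp add: distr_subtree)
  qed simp
  also have "(\<Inter>i\<in>insert None (Some ` {..<K}). (\<lambda>\<eta>. restrict (\<lambda>v. \<eta> v) (I i)) -` A i \<inter> space ?T)
     = {\<eta>. \<eta> [] \<in> X \<and> (\<forall>j<K. subtree j \<eta> \<in> E j)}"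
    unfolding vA by auto
  finally show ?thesis .
qed

lemma prob_root_some_child:
  assumes E: "E \<in> sets (tree_space \<mu>)"
  shows "measure (tree_space \<mu>) {\<eta>. \<eta> [] \<in> X \<and> (\<exists>j<K. subtree j \<eta> \<in> E)} =
     measure (measure_pmf \<mu>) X * (1 - (1 - measure (tree_space \<mu>) E) ^ K)"
proof -
  let ?T = "tree_space \<mu>"
  interpret T: prob_space ?T by (rule prob_space_tree_space)
  have "{\<eta>. \<eta> [] \<in> X \<and> (\<forall>j<K. subtree j \<eta> \<in> F)} \<in> T.events"
    if [measurable]: "F \<in> T.events" for F
  proof -
    have "{\<eta>. \<eta> [] \<in> X \<and> (\<forall>j<K. subtree j \<eta> \<in> F)} =
        ((\<lambda>\<eta>. \<eta> []) -` X \<inter> space ?T) \<inter> {\<eta> \<in> space ?T. \<forall>j\<in>{..<K}. subtree j \<eta> \<in> F}"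
      by auto
    also have "\<dots> \<in> T.events"
      using measurable_sets[OF measurable_coordinate, of X] measurable_sets[OF measurable_subtree that]
      by (intro sets.Int sets.sets_Collect_finite_All) (auto simp: vimage_def)
    finally show ?thesis .
  qed
  note ev = this
  have "{\<eta>. \<eta> [] \<in> X \<and> (\<exists>j<K. subtree j \<eta> \<in> E)} =
      {\<eta>. \<eta> [] \<in> X \<and> (\<forall>j<K. subtree j \<eta> \<in> UNIV)} - {\<eta>. \<eta> [] \<in> X \<and> (\<forall>j<K. subtree j \<eta> \<in> - E)}"
    by auto
  also have "T.prob \<dots> = T.prob {\<eta>. \<eta> [] \<in> X \<and> (\<forall>j<K. subtree j \<eta> \<in> UNIV)}
      - T.prob {\<eta>. \<eta> [] \<in> X \<and> (\<forall>j<K. subtree j \<eta> \<in> - E)}"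
    using ev[of UNIV] ev[of "- E"] E sets.top[of ?T] sets.Diff[OF sets.top E]
    by (intro T.finite_measure_Diff) (auto simp: Compl_eq_Diff_UNIV)
  also have "\<dots> = measure (measure_pmf \<mu>) X * (1 - (1 - T.prob E) ^ K)"
    using E sets.top[of ?T] sets.Diff[OF sets.top E] T.prob_compl[OF E] T.prob_space
    by (subst (1 2) prob_root_children) (auto simp: Compl_eq_Diff_UNIV right_diff_distrib)
  finally show ?thesis .
qed

lemma all_less_two: "(\<forall>j<2. P j) \<longleftrightarrow> P 0 \<and> P (1::nat)"
  by (auto simp: numeral_2_eq_2 less_Suc_eq)

text \<open>
  Along the line of first-born particles \<open>replicate n 0\<close>, the planted trees of their siblings number
  1 are independent trials.  Instead of multiplying their failure probabilities, the proof uses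
  self-similarity: the event \<open>Z\<close> that all trials fail has \<open>P(Z) = (1 - P(E)) P(Z)\<close>, so \<open>P(Z) = 0\<close>.
\<close>

lemma AE_some_branch:
  assumes [measurable]: "E \<in> sets (tree_space \<mu>)" and pos: "measure (tree_space \<mu>) E > 0"
  shows "AE g in brw_space \<nu> \<mu>. \<exists>n. branch g (1 # replicate n 0) \<in> E"
proof -
  let ?T = "tree_space \<mu>"
  interpret T: prob_space ?T by (rule prob_space_tree_space)
  define sp where "sp n = (subtree 0 ^^ n)" for n
  have [measurable]: "sp n \<in> measurable ?T ?T" for n
    by (induction n) (auto simp: sp_def intro: measurable_comp)
  define Z where "Z = {\<eta>. \<forall>n. subtree 1 (sp n \<eta>) \<notin> E}"
  have Z: "Z \<in> T.events"
  proof -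
    have "{\<eta>\<in>space ?T. \<forall>n. subtree 1 (sp n \<eta>) \<notin> E} \<in> T.events" by measurable
    then show ?thesis by (simp add: Z_def)
  qed
  have CE: "- E \<in> T.events" using sets.Diff[OF sets.top assms(1)] by (simp add: Compl_eq_Diff_UNIV)
  have rec: "\<eta> \<in> Z \<longleftrightarrow> subtree 1 \<eta> \<notin> E \<and> subtree 0 \<eta> \<in> Z" for \<eta>
  proof -
    have "\<eta> \<in> Z \<longleftrightarrow> subtree 1 (sp 0 \<eta>) \<notin> E \<and> (\<forall>n. subtree 1 (sp (Suc n) \<eta>) \<notin> E)"
      unfolding Z_def mem_Collect_eq using not0_implies_Suc by metis
    then show ?thesis by (simp add: sp_def Z_def funpow_Suc_right del: funpow.simps(2))
  qed
  have "{\<eta>. \<eta> [] \<in> UNIV \<and> (\<forall>j<2::nat. subtree j \<eta> \<in> (if j = 0 then Z else - E))} = Z"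
  proof (rule set_eqI)
    fix \<eta> show "\<eta> \<in> {\<eta>. \<eta> [] \<in> UNIV \<and> (\<forall>j<2::nat. subtree j \<eta> \<in> (if j = 0 then Z else - E))} \<longleftrightarrow> \<eta> \<in> Z"
      unfolding rec[of \<eta>] mem_Collect_eq all_less_two by auto
  qed
  with prob_root_children[of 2 "\<lambda>j. if j = 0 then Z else - E" \<mu> UNIV] Z CE
  have "T.prob Z = (\<Prod>j<2::nat. T.prob (if j = 0 then Z else - E))"
    by (simp add: measure_pmf.prob_space[simplified])
  also have "\<dots> = T.prob Z * (1 - T.prob E)"
    using T.prob_compl[OF assms(1)] by (simp add: numeral_2_eq_2 Compl_eq_Diff_UNIV)
  finally have "T.prob Z = 0" using pos by (simp add: algebra_simps)
  then have "AE \<eta> in ?T. \<eta> \<notin> Z"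
    using Z by (intro AE_I[of _ _ Z]) (auto simp: T.emeasure_eq_measure)
  from AE_branch[OF _ this, of "[0]" \<nu>] have "AE g in brw_space \<nu> \<mu>. branch g [0] \<notin> Z" by simp
  then show ?thesis
  proof (rule eventually_mono)
    fix g assume "branch g [0] \<notin> Z"
    then obtain n where n: "subtree 1 (sp n (branch g [0])) \<in> E" by (auto simp: Z_def)
    have "sp n (branch g [0]) = branch g (replicate (Suc n) 0)"
      by (induction n) (simp_all add: sp_def subtree_branch)
    with n have "branch g (1 # replicate (Suc n) 0) \<in> E" by (simp only: subtree_branch)
    then show "\<exists>n. branch g (1 # replicate n 0) \<in> E" by blast
  qed
qed

section \<open>Lines of descent steered by an automaton\<close>

text \<open>
  Lines of descent are steered by a finite automaton: in state \<open>i\<close> the line may use an edge with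
  displacement \<open>x\<close> iff \<open>\<tau> i x = Some i'\<close>, and then continues in state \<open>i'\<close>.  The predicate says that
  some admissible line crosses \<open>n\<close> edges, the first being the edge at the bottom of the planted tree.
\<close>

primrec alive :: "(nat \<Rightarrow> int \<Rightarrow> nat option) \<Rightarrow> nat \<Rightarrow> nat \<Rightarrow> nat \<Rightarrow> (nat list \<Rightarrow> int) \<Rightarrow> bool" where
  "alive \<tau> K 0 i \<eta> = True"
| "alive \<tau> K (Suc n) i \<eta> =
     (case \<tau> i (\<eta> []) of None \<Rightarrow> False | Some i' \<Rightarrow> \<exists>j<K. alive \<tau> K n i' (subtree j \<eta>))"

lemma alive_Suc_imp: "alive \<tau> K (Suc n) i \<eta> \<Longrightarrow> alive \<tau> K n i \<eta>"
proof (induction n arbitrary: i \<eta>)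
  case (Suc n)
  from Suc.prems obtain i' j where ij: "\<tau> i (\<eta> []) = Some i'" "j < K" "alive \<tau> K (Suc n) i' (subtree j \<eta>)"
    by (auto simp del: alive.simps(2) simp: alive.simps(2)[of _ _ "Suc n"] split: option.splits)
  from Suc.IH[OF ij(3)] ij show ?case by auto
qed simp

lemma alive_branch_Suc:
  "alive \<tau> K (Suc n) i (branch g w) \<longleftrightarrow>
     (case \<tau> i (edge_step g w) of None \<Rightarrow> False | Some i' \<Rightarrow> \<exists>j<K. alive \<tau> K n i' (branch g (j # w)))"
  by (auto simp: subtree_branch branch_Nil split: option.split)

lemma sets_alive [measurable]: "{\<eta>. alive \<tau> K n i \<eta>} \<in> sets (tree_space \<mu>)"
proof (induction n arbitrary: i)
  case (Suc n)
  have "{\<eta>. alive \<tau> K (Suc n) i \<eta>} =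
      (\<Union>i'. ((\<lambda>\<eta>. \<eta> []) -` {x. \<tau> i x = Some i'} \<inter> space (tree_space \<mu>)) \<inter>
            (\<Union>j<K. subtree j -` {\<eta>. alive \<tau> K n i' \<eta>} \<inter> space (tree_space \<mu>)))"
    by (auto split: option.splits)
  also have "\<dots> \<in> sets (tree_space \<mu>)"
    by (intro sets.countable_UN'' sets.Int sets.finite_UN measurable_sets[OF measurable_coordinate]
          measurable_sets[OF measurable_subtree] Suc) auto
  finally show ?case .
next
  case 0
  have "{\<eta>. alive \<tau> K 0 i \<eta>} = UNIV" by simp
  then show ?case by simp
qed

lemma sets_always_alive [measurable]: "{\<eta>. \<forall>n. alive \<tau> K n i \<eta>} \<in> sets (tree_space \<mu>)"
proof -
  have "{\<eta>. \<forall>n. alive \<tau> K n i \<eta>} = (\<Inter>n. {\<eta>. alive \<tau> K n i \<eta>})" by auto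
  then show ?thesis by (auto intro!: sets.countable_INT' sets_alive)
qed

lemma prob_alive_tendsto:
  "(\<lambda>n. measure (tree_space \<mu>) {\<eta>. alive \<tau> K n i \<eta>}) \<longlonglongrightarrow>
     measure (tree_space \<mu>) {\<eta>. \<forall>n. alive \<tau> K n i \<eta>}"
proof -
  interpret T: prob_space "tree_space \<mu>" by (rule prob_space_tree_space)
  have "decseq (\<lambda>n. {\<eta>. alive \<tau> K n i \<eta>})"
    by (rule decseq_SucI) (use alive_Suc_imp in blast)
  then have "(\<lambda>n. T.prob {\<eta>. alive \<tau> K n i \<eta>}) \<longlonglongrightarrow> T.prob (\<Inter>n. {\<eta>. alive \<tau> K n i \<eta>})"
    by (intro T.finite_Lim_measure_decseq) (auto intro: sets_alive)
  moreover have "(\<Inter>n. {\<eta>. alive \<tau> K n i \<eta>}) = {\<eta>. \<forall>n. alive \<tau> K n i \<eta>}" by auto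
  ultimately show ?thesis by simp
qed

text \<open>
  The survival probabilities up to generation \<open>n\<close> arise by iterating a monotone operator, starting
  from the constant 1.  Therefore any \<open>\<delta> \<le> 1\<close> that the operator does not decrease stays below
  all of them, and below their limit.  To bound a survival probability away from 0 it is thus enough
  to exhibit such a \<open>\<delta>\<close>.
\<close>

lemma always_alive_prob_ge:
  fixes \<delta> :: "nat \<Rightarrow> real"
  assumes "finite F" and \<delta>: "\<And>i. 0 \<le> \<delta> i" "\<And>i. \<delta> i \<le> 1"
    and sub: "\<And>i. \<delta> i \<le> (\<Sum>x\<in>F. pmf \<mu> x * (case \<tau> i x of None \<Rightarrow> 0 | Some i' \<Rightarrow> 1 - (1 - \<delta> i') ^ K))"
  shows "\<delta> i \<le> measure (tree_space \<mu>) {\<eta>. \<forall>n. alive \<tau> K n i \<eta>}"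
proof -
  let ?T = "tree_space \<mu>"
  interpret T: prob_space ?T by (rule prob_space_tree_space)
  let ?S = "\<lambda>n i. {\<eta>. alive \<tau> K n i \<eta>}"
  have "\<delta> i \<le> T.prob (?S n i)" for n
  proof (induction n arbitrary: i)
    case 0
    show ?case using \<delta>(2) T.prob_space by simp
  next
    case (Suc n)
    define G where "G x = {\<eta>. \<eta> [] \<in> {x} \<and>
      (\<exists>j<K. subtree j \<eta> \<in> (case \<tau> i x of None \<Rightarrow> {} | Some i' \<Rightarrow> ?S n i'))}" for x
    have "T.prob (G x) = pmf \<mu> x * (case \<tau> i x of None \<Rightarrow> 0 | Some i' \<Rightarrow> 1 - (1 - T.prob (?S n i')) ^ K)" for x
      unfolding G_def by (subst prob_root_some_child) (auto simp: pmf.rep_eq sets_alive split: option.splits)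
    note G = this
    have Gs: "G x \<in> T.events" for x
    proof -
      have "G x = ((\<lambda>\<eta>. \<eta> []) -` {x} \<inter> space ?T) \<inter>
        (\<Union>j<K. subtree j -` (case \<tau> i x of None \<Rightarrow> {} | Some i' \<Rightarrow> ?S n i') \<inter> space ?T)"
        by (auto simp: G_def)
      also have "\<dots> \<in> T.events"
        by (intro sets.Int sets.finite_UN measurable_sets[OF measurable_coordinate]
          measurable_sets[OF measurable_subtree]) (auto split: option.splits intro: sets_alive)
      finally show ?thesis .
    qed
    have "\<delta> i \<le> (\<Sum>x\<in>F. pmf \<mu> x * (case \<tau> i x of None \<Rightarrow> 0 | Some i' \<Rightarrow> 1 - (1 - \<delta> i') ^ K))"
      by (rule sub)
    also have "\<dots> \<le> (\<Sum>x\<in>F. T.prob (G x))"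
      unfolding G
    proof (intro sum_mono mult_left_mono)
      fix x
      show "(case \<tau> i x of None \<Rightarrow> 0 | Some i' \<Rightarrow> 1 - (1 - \<delta> i') ^ K)
         \<le> (case \<tau> i x of None \<Rightarrow> 0 | Some i' \<Rightarrow> 1 - (1 - T.prob (?S n i')) ^ K)"
        using Suc.IH by (auto split: option.splits intro!: power_mono)
    qed simp
    also have "\<dots> = T.prob (\<Union>x\<in>F. G x)"
      using Gs assms(1)
      by (intro T.finite_measure_finite_Union[symmetric]) (auto simp: disjoint_family_on_def G_def)
    also have "\<dots> \<le> T.prob (?S (Suc n) i)"
      by (intro T.finite_measure_mono sets_alive) (auto simp: G_def split: option.splits)
    finally show ?case .
  qed
  then show ?thesis by (intro LIMSEQ_le_const[OF prob_alive_tendsto]) auto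
qed

text \<open>
  State 0 runs at full speed in direction \<open>s\<close>.  State 1 starts with one step of length 1, which moves
  the line to the sites of the other parity.
\<close>

definition steady :: "int \<Rightarrow> nat \<Rightarrow> int \<Rightarrow> nat option" where
  "steady s i x = (if i = 0 \<and> x = 2 * s \<or> i = 1 \<and> x = s then Some 0 else None)"

text \<open>
  Full speed to the right, except that a step of length 1 is permitted once the counter has reached
  0; it resets the counter to \<open>k\<close>.  So two short steps are at least \<open>k + 1\<close> generations apart, and
  the speed is at least \<open>2 - 1 / (k + 1)\<close>.
\<close>

definition sparing :: "nat \<Rightarrow> nat \<Rightarrow> int \<Rightarrow> nat option" where
  "sparing k i x = (if x = 2 then Some (i - 1) else if x = 1 \<and> i = 0 then Some k else None)"

lemma steady_0: "steady s 0 x = (if x = 2 * s then Some 0 else None)"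
  and steady_1: "steady s (Suc 0) x = (if x = s then Some 0 else None)"
  by (simp_all add: steady_def)

lemma strict_Bernoulli:
  fixes q :: real
  assumes "0 < q" "q \<le> 1" "2 \<le> K"
  shows "1 - (1 - q) ^ K < real K * q"
proof -
  obtain k where K: "K = Suc (Suc k)" using assms(3) by (metis add_2_eq_Suc le_Suc_ex)
  have "1 - real (Suc k) * q \<le> (1 - q) ^ Suc k"
    using Bernoulli_inequality[of "- q" "Suc k"] assms by simp
  then have "(1 - real (Suc k) * q) * (1 - q) \<le> (1 - q) ^ K"
    using mult_right_mono[of "1 - real (Suc k) * q" "(1 - q) ^ Suc k" "1 - q"] assms
    by (simp add: K mult.commute)
  moreover have "real (Suc k) * q * q > 0" using assms by simp
  ultimately show ?thesis by (simp add: K algebra_simps)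
qed

section \<open>Critical and supercritical lines\<close>

text \<open>
  The full-speed lines form a Galton-Watson process with mean at most 1.  Its survival probability
  \<open>q\<close> solves \<open>q = p (1 - (1 - q)^K)\<close> with \<open>K p \<le> 1\<close>, and by the strict Bernoulli inequality only
  \<open>q = 0\<close> does.
\<close>

lemma critical_steady_dies:
  assumes "2 \<le> K" "real K * pmf \<mu> (2 * s) \<le> 1"
  shows "AE \<eta> in tree_space \<mu>. \<exists>n. \<not> alive (steady s) K n 0 \<eta>"
proof -
  let ?T = "tree_space \<mu>"
  interpret T: prob_space ?T by (rule prob_space_tree_space)
  let ?q = "\<lambda>n. T.prob {\<eta>. alive (steady s) K n 0 \<eta>}"
  let ?A = "{\<eta>. \<forall>n. alive (steady s) K n 0 \<eta>}"
  have "{\<eta>. alive (steady s) K (Suc n) 0 \<eta>} =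
      {\<eta>. \<eta> [] \<in> {2 * s} \<and> (\<exists>j<K. subtree j \<eta> \<in> {\<eta>. alive (steady s) K n 0 \<eta>})}" for n
    by (auto simp: steady_def)
  then have rec: "?q (Suc n) = pmf \<mu> (2 * s) * (1 - (1 - ?q n) ^ K)" for n
    by (simp only: prob_root_some_child[OF sets_alive] pmf.rep_eq)
  have "(\<lambda>n. ?q (Suc n)) \<longlonglongrightarrow> T.prob ?A"
    by (rule LIMSEQ_Suc) (rule prob_alive_tendsto)
  moreover have "(\<lambda>n. ?q (Suc n)) \<longlonglongrightarrow> pmf \<mu> (2 * s) * (1 - (1 - T.prob ?A) ^ K)"
    unfolding rec by (intro tendsto_intros prob_alive_tendsto)
  ultimately have eq: "T.prob ?A = pmf \<mu> (2 * s) * (1 - (1 - T.prob ?A) ^ K)"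
    by (rule LIMSEQ_unique)
  have "T.prob ?A = 0"
  proof (rule ccontr)
    assume "T.prob ?A \<noteq> 0"
    then have pos: "0 < T.prob ?A" by (simp add: zero_less_measure_iff)
    then have p: "0 < pmf \<mu> (2 * s)" using eq by (metis mult_zero_left pmf_nonneg order_less_le)
    have "1 - (1 - T.prob ?A) ^ K < real K * T.prob ?A"
      using strict_Bernoulli[OF pos T.prob_le_1 assms(1)] .
    then have "T.prob ?A < pmf \<mu> (2 * s) * (real K * T.prob ?A)"
      using p by (subst eq) (rule mult_strict_left_mono)
    also have "\<dots> \<le> T.prob ?A"
      using mult_right_mono[OF assms(2), of "T.prob ?A"] pos by (simp add: mult_ac)
    finally show False by simp
  qed
  then have "AE \<eta> in ?T. \<eta> \<notin> ?A"
    by (intro AE_I[of _ _ ?A]) (auto simp: T.emeasure_eq_measure sets_always_alive)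
  then show ?thesis by simp
qed

text \<open>
  Now the mean is at least \<open>34 / 17 = 2\<close>.  The constant \<open>\<delta> = 1 / 34\<close> works because
  \<open>(33 / 34)^34 \<le> 1 / 2\<close>.
\<close>

lemma supercritical_steady_survives:
  assumes K: "34 \<le> K" and p: "pmf \<mu> (2 * s) \<ge> 1 / 17" "pmf \<mu> s \<ge> 1 / 17" "s \<noteq> 0" and "i \<le> 1"
  shows "0 < measure (tree_space \<mu>) {\<eta>. \<forall>n. alive (steady s) K n i \<eta>}"
proof -
  define \<delta> :: "nat \<Rightarrow> real" where "\<delta> i = (if i \<le> 1 then 1 / 34 else 0)" for i
  have "(33 / 34 :: real) ^ K \<le> (33 / 34) ^ 34" using K by (intro power_decreasing) auto
  also have "\<dots> \<le> 1 / 2" by (simp add: power_divide)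
  finally have half: "1 / 2 \<le> 1 - (33 / 34 :: real) ^ K" by simp
  have ge: "1 / 34 \<le> q * (1 - (33 / 34) ^ K)" if "1 / 17 \<le> q" for q :: real
    using mult_mono[OF that half] that by simp
  have "\<delta> i \<le> measure (tree_space \<mu>) {\<eta>. \<forall>n. alive (steady s) K n i \<eta>}"
  proof (rule always_alive_prob_ge[where F = "{s, 2 * s}"])
    fix i show "\<delta> i \<le> (\<Sum>x\<in>{s, 2 * s}. pmf \<mu> x *
        (case steady s i x of None \<Rightarrow> 0 | Some i' \<Rightarrow> 1 - (1 - \<delta> i') ^ K))"
      using ge[OF p(1)] ge[OF p(2)] p(3) by (auto simp: \<delta>_def steady_def)
  qed (auto simp: \<delta>_def)
  then show ?thesis using \<open>i \<le> 1\<close> by (simp add: \<delta>_def)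
qed

lemma four_children_bounds:
  fixes q :: real
  assumes "0 \<le> q" "q \<le> 1"
  shows "q - 3 / 2 * q\<^sup>2 \<le> 1 / 4 * (1 - (1 - q) ^ 4)" "q / 4 \<le> 1 / 4 * (1 - (1 - q) ^ 4)"
proof -
  have "1 / 4 * (1 - (1 - q) ^ 4) - (q - 3 / 2 * q\<^sup>2) = q ^ 3 * (1 - q / 4)"
    by (simp add: algebra_simps power2_eq_square power3_eq_cube power4_eq_xxxx)
  moreover have "0 \<le> q ^ 3 * (1 - q / 4)" using assms by (intro mult_nonneg_nonneg) auto
  ultimately show "q - 3 / 2 * q\<^sup>2 \<le> 1 / 4 * (1 - (1 - q) ^ 4)" by linarith
  have "(1 - q) ^ 4 \<le> (1 - q) ^ 1" using assms by (intro power_decreasing) auto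
  then show "q / 4 \<le> 1 / 4 * (1 - (1 - q) ^ 4)" by simp
qed

text \<open>
  Full-speed lines are exactly critical here, so the rare permission to use a short step tips the
  balance.  Criticality costs a quadratic term \<open>3/2 \<delta>\<^sub>0\<^sup>2\<close>, whereas the short step gains
  the linear term \<open>\<delta>\<^sub>k / 4\<close>.  In the other states the crude loss of a factor 4 per step is
  affordable, so \<open>\<delta>\<^sub>i = \<epsilon> / 4\<^sup>i\<close>, with \<open>\<epsilon>\<close> small compared with \<open>1 / 4\<^sup>k\<close>.
\<close>

lemma critical_sparing_survives:
  assumes p: "pmf \<mu> 1 = 1 / 4" "pmf \<mu> 2 = 1 / 4"
  shows "0 < measure (tree_space \<mu>) {\<eta>. \<forall>n. alive (sparing k) 4 n 0 \<eta>}"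
proof -
  define \<epsilon> :: real where "\<epsilon> = 1 / 4 ^ (k + 2)"
  define \<delta> where "\<delta> i = \<epsilon> / 4 ^ i" for i :: nat
  have pow: "(1::real) \<le> 4 ^ i" for i :: nat by (rule one_le_power) simp
  have \<epsilon>: "0 < \<epsilon>" "\<epsilon> \<le> 1" unfolding \<epsilon>_def using pow[of "k + 2"] by (simp_all del: power_add_numeral)
  have \<delta>: "0 \<le> \<delta> i" "\<delta> i \<le> 1" for i
    using \<epsilon> order_trans[OF \<epsilon>(2) pow[of i]] by (auto simp: \<delta>_def divide_le_eq)
  have "\<delta> 0 \<le> measure (tree_space \<mu>) {\<eta>. \<forall>n. alive (sparing k) 4 n 0 \<eta>}"
  proof (rule always_alive_prob_ge[where F = "{1, 2}"])
    fix i
    show "\<delta> i \<le> (\<Sum>x\<in>{1, 2}. pmf \<mu> x * (case sparing k i x of None \<Rightarrow> 0 | Some i' \<Rightarrow> 1 - (1 - \<delta> i') ^ 4))"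
    proof (cases i)
      case 0
      have "\<delta> k = 4 * \<epsilon>\<^sup>2 * 4" by (simp add: \<delta>_def \<epsilon>_def power2_eq_square power_add field_simps)
      then have "3 / 2 * (\<delta> 0)\<^sup>2 \<le> \<delta> k / 4" by (simp add: \<delta>_def)
      with four_children_bounds(1)[OF \<delta>, of 0] four_children_bounds(2)[OF \<delta>, of k]
      have "\<delta> 0 \<le> 1 / 4 * (1 - (1 - \<delta> k) ^ 4) + 1 / 4 * (1 - (1 - \<delta> 0) ^ 4)" by linarith
      then show ?thesis by (simp add: 0 sparing_def p)
    next
      case (Suc i')
      have "\<delta> i = \<delta> i' / 4" by (simp add: \<delta>_def Suc)
      with four_children_bounds(2)[OF \<delta>, of i'] show ?thesis by (simp add: Suc sparing_def p)
    qed
  qed (use \<delta> in auto)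
  then show ?thesis using \<epsilon> by (simp add: \<delta>_def)
qed

text \<open>
  A full-speed line visits sites of one parity only.  Two siblings whose lines start with steps of
  length 2 and 1 cover both parities.
\<close>

lemma AE_some_steady_pair:
  assumes "34 \<le> K" "pmf \<mu> (2 * s) \<ge> 1 / 17" "pmf \<mu> s \<ge> 1 / 17" "s \<noteq> 0"
  shows "AE g in brw_space \<nu> \<mu>. \<exists>n. \<forall>i<2. \<forall>t. alive (steady s) K t i (branch g (i # 1 # replicate n 0))"
proof -
  let ?T = "tree_space \<mu>"
  interpret T: prob_space ?T by (rule prob_space_tree_space)
  let ?E = "\<lambda>i. {\<eta>. \<forall>t. alive (steady s) K t i \<eta>}"
  let ?P = "{\<eta>. \<forall>i<2. subtree i \<eta> \<in> ?E i}"
  have "?P = (\<Inter>i\<in>{..<2}. subtree i -` ?E i \<inter> space ?T)" by auto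
  also have "\<dots> \<in> T.events"
    using lessThan_empty_iff[of "2::nat"]
    by (intro sets.finite_INT measurable_sets[OF measurable_subtree] sets_always_alive) auto
  finally have "?P \<in> T.events" .
  moreover have "T.prob ?P = T.prob (?E 0) * T.prob (?E 1)"
    using prob_root_children[of 2 ?E \<mu> UNIV]
    by (simp add: sets_always_alive measure_pmf.prob_space[simplified] numeral_2_eq_2)
  ultimately have "AE g in brw_space \<nu> \<mu>. \<exists>n. branch g (1 # replicate n 0) \<in> ?P"
    using supercritical_steady_survives[OF assms, of 0] supercritical_steady_survives[OF assms, of 1]
    by (intro AE_some_branch) simp_all
  then show ?thesis by (simp add: subtree_branch)
qed

lemma AE_some_sparing:
  assumes "pmf \<mu> 1 = 1 / 4" "pmf \<mu> 2 = 1 / 4"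
  shows "AE g in brw_space \<nu> \<mu>. \<exists>n. \<forall>t. alive (sparing k) 4 t 0 (branch g (1 # replicate n 0))"
  using AE_some_branch[where \<nu> = \<nu>, OF sets_always_alive critical_sparing_survives[OF assms, of k]] by simp

lemma AE_no_steady:
  assumes "2 \<le> K" "real K * pmf \<mu> (2 * s) \<le> 1"
  shows "AE g in brw_space \<nu> \<mu>. \<forall>w. w \<noteq> [] \<longrightarrow> (\<exists>n. \<not> alive (steady s) K n 0 (branch g w))"
proof -
  have "AE g in brw_space \<nu> \<mu>. w \<noteq> [] \<longrightarrow> (\<exists>n. \<not> alive (steady s) K n 0 (branch g w))" for w
    using AE_branch[OF _ critical_steady_dies[OF assms]] by (cases "w = []") simp_all
  then show ?thesis by (simp add: AE_all_countable)
qed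

section \<open>What surviving lines say about occupied sites\<close>

lemma position_Cons: "position g x (j # u) = position g x u + edge_step g (j # u)"
  by (simp add: edge_step_def)

declare position.simps(2) [simp del]

lemma particles_eq:
  assumes "\<And>u. fst (g u) = K"
  shows "particles g n = {u. set u \<subseteq> {..<K} \<and> length u = n}"
proof (induction n)
  case (Suc n)
  show ?case
  proof (rule set_eqI)
    fix u show "u \<in> particles g (Suc n) \<longleftrightarrow> u \<in> {u. set u \<subseteq> {..<K} \<and> length u = Suc n}"
      using assms by (cases u) (auto simp: Suc)
  qed
qed auto

lemma occupied_finite_nonempty:
  assumes "\<And>u. fst (g u) = K" "0 < K"
  shows "finite (occupied g x n)" "occupied g x n \<noteq> {}"
proof -
  show "finite (occupied g x n)"
    unfolding occupied_def particles_eq[where K = K, OF assms(1)]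
    by (intro finite_imageI finite_lists_length_eq) simp
  have "replicate n 0 \<in> particles g n" using assms by (auto simp: particles_eq[where K = K])
  then show "occupied g x n \<noteq> {}" by (auto simp: occupied_def)
qed

lemma steady_line:
  assumes "\<And>u. fst (g u) = K"
  shows "alive (steady s) K n 0 (branch g (j # u)) \<Longrightarrow> j < K \<Longrightarrow> u \<in> particles g m \<Longrightarrow>
    position g x u + 2 * s * int n \<in> occupied g x (m + n)"
proof (induction n arbitrary: j u m)
  case 0
  then show ?case by (simp add: occupied_def)
next
  case (Suc n)
  from Suc.prems obtain j' where j': "edge_step g (j # u) = 2 * s" "j' < K"
      "alive (steady s) K n 0 (branch g (j' # j # u))"
    by (auto simp: alive_branch_Suc steady_0 steady_1 simp del: alive.simps split: if_splits)
  have "j # u \<in> particles g (Suc m)" using Suc.prems assms by simp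
  from Suc.IH[OF j'(3,2) this] show ?case
    by (simp add: position_Cons j'(1) algebra_simps)
qed

lemma steady_line_odd:
  assumes "\<And>u. fst (g u) = K" "alive (steady s) K (Suc n) 1 (branch g (j # u))" "j < K" "u \<in> particles g m"
  shows "position g x u + s + 2 * s * int n \<in> occupied g x (m + Suc n)"
proof -
  from assms(2) obtain j' where j': "edge_step g (j # u) = s" "j' < K"
      "alive (steady s) K n 0 (branch g (j' # j # u))"
    by (auto simp: alive_branch_Suc steady_0 steady_1 simp del: alive.simps split: if_splits)
  have "j # u \<in> particles g (Suc m)" using assms by simp
  from steady_line[OF assms(1) j'(3,2) this, of x] show ?thesis
    by (simp add: position_Cons j'(1))
qed

text \<open>
  The invariant is that \<open>k + 1\<close> times the distance lost against speed 2 is at most the elapsed time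
  plus the final counter minus the initial counter, and the counter never exceeds \<open>k\<close>.
\<close>

lemma sparing_line:
  assumes "\<And>u. fst (g u) = K"
  shows "alive (sparing k) K n i (branch g (j # u)) \<Longrightarrow> i \<le> k \<Longrightarrow> j < K \<Longrightarrow> u \<in> particles g m \<Longrightarrow>
    \<exists>y\<in>occupied g x (m + n). (int k + 1) * (2 * int n - (y - position g x u)) \<le> int n + int k - int i"
proof (induction n arbitrary: i j u m)
  case 0
  then have "position g x u \<in> occupied g x (m + 0)" by (simp add: occupied_def)
  with 0 show ?case by (intro bexI[of _ "position g x u"]) auto
next
  case (Suc n)
  from Suc.prems obtain i' j' where j': "sparing k i (edge_step g (j # u)) = Some i'" "j' < K"
      "alive (sparing k) K n i' (branch g (j' # j # u))"
    by (auto simp: alive_branch_Suc simp del: alive.simps split: option.splits)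
  have i': "i' \<le> k" using j'(1) Suc.prems by (auto simp: sparing_def split: if_splits)
  have "j # u \<in> particles g (Suc m)" using Suc.prems assms by simp
  from Suc.IH[OF j'(3) i' j'(2) this] obtain y where y: "y \<in> occupied g x (Suc m + n)"
    "(int k + 1) * (2 * int n - (y - position g x u - edge_step g (j # u))) \<le> int n + int k - int i'"
    by (auto simp: position_Cons algebra_simps)
  have "(int k + 1) * (2 - edge_step g (j # u)) \<le> 1 + int i' - int i"
    using j'(1) by (auto simp: sparing_def split: if_splits)
  with y(2) have "(int k + 1) * (2 * int (Suc n) - (y - position g x u)) \<le> int (Suc n) + int k - int i"
    by (simp add: algebra_simps)
  with y(1) show ?case by auto
qed

section \<open>The front falls behind when full-speed lines die out\<close>

definition lag :: "genealogy \<Rightarrow> int \<Rightarrow> nat list \<Rightarrow> int" where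
  "lag g s u = 2 * int (length u) - s * position g 0 u"

lemma lag_append_ge:
  assumes "\<And>w. s * edge_step g w \<le> 2"
  shows "lag g s u \<le> lag g s (v @ u)"
proof (induction v)
  case (Cons j v)
  then show ?case using assms[of "j # v @ u"] by (simp add: lag_def position_Cons algebra_simps)
qed simp

lemma lag_grows_when_line_dies:
  assumes s: "s * s = 1" and le: "\<And>w. s * edge_step g w \<le> 2"
  shows "\<not> alive (steady s) K n 0 (branch g (j # u)) \<Longrightarrow> set v \<subseteq> {..<K} \<Longrightarrow> n \<le> length v \<Longrightarrow>
    lag g s u < lag g s (v @ j # u)"
proof (induction n arbitrary: j u v)
  case (Suc n)
  show ?case
  proof (cases "edge_step g (j # u) = 2 * s")
    case True
    from Suc.prems obtain v' j' where v: "v = v' @ [j']" by (cases v rule: rev_cases) auto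
    have "\<not> alive (steady s) K n 0 (branch g (j' # j # u))"
      using Suc.prems v True by (auto simp: alive_branch_Suc steady_0 simp del: alive.simps)
    from Suc.IH[OF this, of v'] Suc.prems v have "lag g s (j # u) < lag g s (v @ j # u)" by simp
    with lag_append_ge[OF le, of u "[j]"] show ?thesis by simp
  next
    case False
    have "s * edge_step g (j # u) \<noteq> 2"
    proof
      assume "s * edge_step g (j # u) = 2"
      then have "s * s * edge_step g (j # u) = 2 * s" by (simp add: mult.assoc)
      with False s show False by simp
    qed
    with le[of "j # u"] have "lag g s u < lag g s (j # u)"
      by (simp add: lag_def position_Cons algebra_simps)
    with lag_append_ge[OF le, of "j # u" v] show ?thesis by simp
  qed
qed simp

text \<open>
  Since steps have length at most 2, the lag never decreases along a line of descent, and it stays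
  constant only along full-speed lines.  If all of these are finite, then some finite depth forces
  every line starting in \<open>u\<close> to lose at least 1.  As there are finitely many particles at that
  depth, the argument can be repeated from each of them, and any loss \<open>c\<close> is eventually enforced.
\<close>

lemma lag_unbounded_when_lines_die:
  assumes s: "s * s = 1" and le: "\<And>w. s * edge_step g w \<le> 2"
    and dies: "\<And>w. w \<noteq> [] \<Longrightarrow> \<exists>n. \<not> alive (steady s) K n 0 (branch g w)"
  shows "\<exists>N. \<forall>v. set v \<subseteq> {..<K} \<and> N \<le> length v \<longrightarrow> lag g s u + int c \<le> lag g s (v @ u)"
proof (induction c arbitrary: u)
  case 0
  show ?case using lag_append_ge[OF le] by auto
next
  case (Suc c)
  have "\<exists>f. \<forall>j. \<not> alive (steady s) K (f j) 0 (branch g (j # u))"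
    using dies by (intro choice) simp
  then obtain f where f: "\<And>j. \<not> alive (steady s) K (f j) 0 (branch g (j # u))" by blast
  \<comment> \<open>The surplus of one generation is the edge from \<open>u\<close> to its child.\<close>
  define N1 where "N1 = Suc (\<Sum>j<K. f j)"
  have one: "lag g s u + 1 \<le> lag g s (w @ u)" if "set w \<subseteq> {..<K}" "length w = N1" for w
  proof -
    from that obtain v j where w: "w = v @ [j]" by (cases w rule: rev_cases) (auto simp: N1_def)
    with that have "f j \<le> (\<Sum>j<K. f j)" by (intro member_le_sum) auto
    with that w have "f j \<le> length v" by (simp add: N1_def)
    with lag_grows_when_line_dies[OF s le f, of v j] that w show ?thesis by auto
  qed
  have "\<exists>h. \<forall>w v. set v \<subseteq> {..<K} \<and> h w \<le> length v \<longrightarrow> lag g s (w @ u) + int c \<le> lag g s (v @ w @ u)"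
    using Suc.IH by (intro choice) blast
  then obtain h where h: "\<And>w v. set v \<subseteq> {..<K} \<Longrightarrow> h w \<le> length v \<Longrightarrow>
      lag g s (w @ u) + int c \<le> lag g s (v @ w @ u)" by blast
  define W where "W = {w. set w \<subseteq> {..<K} \<and> length w = N1}"
  have W: "finite W" unfolding W_def by (rule finite_lists_length_eq) simp
  show ?case
  proof (intro exI[of _ "N1 + (\<Sum>w\<in>W. h w)"] allI impI)
    fix v assume v: "set v \<subseteq> {..<K} \<and> N1 + (\<Sum>w\<in>W. h w) \<le> length v"
    define v' w where "v' = take (length v - N1) v" and "w = drop (length v - N1) v"
    have split: "v = v' @ w" by (simp add: v'_def w_def)
    have "w \<in> W" using v set_drop_subset[of "length v - N1" v] by (auto simp: W_def w_def)
    then have "h w \<le> (\<Sum>w\<in>W. h w)" using W by (intro member_le_sum) auto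
    also have "\<dots> \<le> length v - N1" using conjunct2[OF v] by linarith
    also have "\<dots> = length v'" by (simp add: v'_def)
    finally have "lag g s (w @ u) + int c \<le> lag g s (v' @ w @ u)"
      using v split by (intro h) auto
    with one[of w] \<open>w \<in> W\<close> show "lag g s u + int (Suc c) \<le> lag g s (v @ u)"
      by (simp add: split W_def)
  qed
qed

lemma occupied_far_behind:
  assumes K: "\<And>u. fst (g u) = K" and s: "s * s = 1" and le: "\<And>w. s * edge_step g w \<le> 2"
    and dies: "\<And>w. w \<noteq> [] \<Longrightarrow> \<exists>n. \<not> alive (steady s) K n 0 (branch g w)"
  shows "\<exists>N. \<forall>n\<ge>N. \<forall>y\<in>occupied g 0 n. s * y \<le> 2 * int n - c"
proof -
  obtain N where N: "\<And>v. set v \<subseteq> {..<K} \<Longrightarrow> N \<le> length v \<Longrightarrow> lag g s [] + int (nat c) \<le> lag g s (v @ [])"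
    using lag_unbounded_when_lines_die[OF s le dies, where c = "nat c" and u = "[]"] by blast
  show ?thesis
  proof (intro exI[of _ N] allI impI ballI)
    fix n y assume "N \<le> n" "y \<in> occupied g 0 n"
    then obtain v where "set v \<subseteq> {..<K}" "length v = n" "y = position g 0 v"
      by (auto simp: occupied_def particles_eq[where K = K, OF K])
    with N[of v] \<open>N \<le> n\<close> show "s * y \<le> 2 * int n - c"
      by (simp add: lag_def split: if_splits)
  qed
qed

lemma occupied_le:
  assumes le: "\<And>w. s * edge_step g w \<le> 2" and "y \<in> occupied g x n"
  shows "s * y \<le> s * x + 2 * int n"
proof -
  have "u \<in> particles g n \<Longrightarrow> s * position g x u \<le> s * x + 2 * int n" for u
  proof (induction n arbitrary: u)
    case (Suc n)
    then obtain j v where u: "u = j # v" "v \<in> particles g n" by auto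
    with Suc.IH[OF u(2)] le[of u] show ?case by (simp add: position_Cons algebra_simps)
  qed simp
  with assms(2) show ?thesis by (auto simp: occupied_def)
qed

section \<open>The race for a far site\<close>

text \<open>
  Blue reaches the site at distance \<open>d\<close> beyond \<open>A\<close> after \<open>d / 2\<close> generations, up to an additive
  constant.  Red needs \<open>d / 2\<close> plus half of its lag, again up to a constant, and the lag eventually
  exceeds any bound.
\<close>

lemma sites_beyond_first_blue:
  assumes s: "s * s = 1"
    and red: "\<And>n y. y \<in> occupied gr 0 n \<Longrightarrow> s * y \<le> 2 * int n"
      "\<And>c. \<exists>N. \<forall>n\<ge>N. \<forall>y\<in>occupied gr 0 n. s * y \<le> 2 * int n - c"
    and blue: "\<And>n. A + 2 * s * int n \<in> occupied gb 1 (m + n)"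
      "\<And>n. A + s + 2 * s * int n \<in> occupied gb 1 (m + Suc n)"
  shows "\<exists>Y. \<forall>y. Y \<le> s * y \<longrightarrow> first_visit gb 1 y < first_visit gr 0 y"
proof -
  from red(2)[of "2 * int m + 2 - s * A"] obtain N where
    N: "\<And>n y. N \<le> n \<Longrightarrow> y \<in> occupied gr 0 n \<Longrightarrow> s * y \<le> 2 * int n - (2 * int m + 2 - s * A)"
    by blast
  show ?thesis
  proof (intro exI[of _ "max (s * A) (2 * int N)"] allI impI)
    fix y assume y: "max (s * A) (2 * int N) \<le> s * y"
    define d where "d = nat (s * y - s * A)"
    have d: "s * y = s * A + int d" using y by (simp add: d_def)
    have "s * (s * y) = s * (s * A + int d)" by (simp only: d)
    then have yd: "y = A + s * int d"
      using s by (simp add: distrib_left mult.assoc[symmetric])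
    have "\<exists>T. y \<in> occupied gb 1 T \<and> 2 * T \<le> 2 * m + d + 1"
    proof (cases "even d")
      case True
      then obtain n where "d = 2 * n" by blast
      with blue(1)[of n] yd show ?thesis by (intro exI[of _ "m + n"]) (simp add: mult_ac)
    next
      case False
      then obtain n where "d = 2 * n + 1" by (elim oddE)
      with blue(2)[of n] yd show ?thesis by (intro exI[of _ "m + Suc n"]) (simp add: algebra_simps)
    qed
    then obtain T where T: "y \<in> occupied gb 1 T" "2 * T \<le> 2 * m + d + 1" by blast
    have "first_visit gb 1 y \<le> enat T"
      unfolding first_visit_def using T(1) by (intro INF_lower) simp
    also have "enat T < enat (Suc T)" by simp
    also have "enat (Suc T) \<le> first_visit gr 0 y"
      unfolding first_visit_def
    proof (intro INF_greatest)
      fix t assume "t \<in> {n. y \<in> occupied gr 0 n}"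
      then have t: "y \<in> occupied gr 0 t" by simp
      from red(1)[OF t] y have "N \<le> t" by linarith
      from N[OF this t] d T(2) show "enat (Suc T) \<le> enat t" by simp
    qed
    finally show "first_visit gb 1 y < first_visit gr 0 y" .
  qed
qed

section \<open>Speed of the right-most particles\<close>

lemma speed_two:
  fixes M :: "nat \<Rightarrow> int"
  assumes upper: "\<And>n. M n \<le> 2 * int n + 1"
    and lower: "\<And>k::nat. \<exists>C N. \<forall>n\<ge>N. (int k + 1) * (2 * int n - M n) \<le> int n + C"
  shows "(\<lambda>n. real_of_int (M n) / real n) \<longlonglongrightarrow> 2"
proof (rule LIMSEQ_I)
  fix r :: real assume r: "0 < r"
  obtain k :: nat where k: "1 / (real k + 1) < r / 2"
    using reals_Archimedean[of "r / 2"] r by (auto simp: inverse_eq_divide add.commute)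
  obtain C N where CN: "\<And>n. N \<le> n \<Longrightarrow> (int k + 1) * (2 * int n - M n) \<le> int n + C"
    using lower by blast
  obtain n0 where n0: "max 1 (2 * \<bar>real_of_int C\<bar> + 2) / r < real n0" using reals_Archimedean2 by blast
  show "\<exists>n0. \<forall>n\<ge>n0. norm (real_of_int (M n) / real n - 2) < r"
  proof (intro exI[of _ "max N (Suc n0)"] allI impI)
    fix n assume n: "max N (Suc n0) \<le> n"
    then have pos: "0 < real n" by simp
    have "max 1 (2 * \<bar>real_of_int C\<bar> + 2) / r < real n" 
    proof -
      have "real n0 \<le> real n" using n by simp
      with n0 show ?thesis by linarith
    qed
    then have big: "2 * \<bar>real_of_int C\<bar> + 2 < r * real n"
      using r by (simp add: divide_less_eq mult.commute)
    have "real_of_int (M n) \<le> real_of_int (2 * int n + 1)"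
      using upper[of n] by (simp only: of_int_le_iff)
    then have up: "real_of_int (M n) - 2 * real n \<le> 1" by simp
    have "real_of_int ((int k + 1) * (2 * int n - M n)) \<le> real_of_int (int n + C)"
      using CN[of n] n by (simp only: of_int_le_iff)
    then have "(real k + 1) * (2 * real n - real_of_int (M n)) \<le> real n + real_of_int C" by simp
    then have "2 * real n - real_of_int (M n) \<le> (real n + real_of_int C) / (real k + 1)"
      by (simp add: pos_le_divide_eq mult.commute add_pos_nonneg)
    also have "\<dots> \<le> real n / (real k + 1) + \<bar>real_of_int C\<bar>"
    proof -
      have "real_of_int C / (real k + 1) \<le> \<bar>real_of_int C\<bar> / 1"
        by (intro frac_le) auto
      then show ?thesis by (simp add: add_divide_distrib)
    qed
    also have "real n / (real k + 1) < r / 2 * real n"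
      using mult_strict_right_mono[OF k pos] by simp
    finally have "2 * real n - real_of_int (M n) < r * real n" using big by simp
    moreover have "real_of_int (M n) - 2 * real n < r * real n" using up big by linarith
    ultimately have "\<bar>real_of_int (M n) - 2 * real n\<bar> < r * real n" by linarith
    moreover have "real_of_int (M n) / real n - 2 = (real_of_int (M n) - 2 * real n) / real n"
      using pos by (simp add: field_simps)
    ultimately show "norm (real_of_int (M n) / real n - 2) < r"
      using pos by (simp add: abs_divide pos_divide_less_eq)
  qed
qed

section \<open>Almost sure properties of the displacements\<close>

lemma AE_offspring_number: "AE g in brw_space (return_pmf K) \<mu>. \<forall>u. fst (g u) = K"
proof -
  have "AE x in offspring_space (return_pmf K) \<mu>. fst x = K"
  proof -
    let ?P = "\<Pi>\<^sub>M j\<in>(UNIV::nat set). measure_pmf \<mu>"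
    have "distr (measure_pmf (return_pmf K) \<Otimes>\<^sub>M ?P) (measure_pmf (return_pmf K)) fst = measure_pmf (return_pmf K)"
      by (intro prob_space.distr_pair_fst prob_space_PiM prob_space_measure_pmf)
    then show ?thesis
      unfolding offspring_space_def
      by (intro AE_distrD[OF measurable_fst, where P = "\<lambda>n. n = K"]) (simp only: AE_measure_pmf_iff, simp)
  qed
  then have "AE g in brw_space (return_pmf K) \<mu>. fst (g u) = K" for u
    unfolding brw_space_def
    by (intro AE_PiM_component[where P = "\<lambda>x. fst x = K"] prob_space_offspring_space) auto
  then show ?thesis by (simp add: AE_all_countable)
qed

lemma AE_edge_step_bounded:
  assumes "set_pmf \<mu> \<subseteq> {-2..2}"
  shows "AE g in brw_space \<nu> \<mu>. \<forall>w. \<bar>edge_step g w\<bar> \<le> 2"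
proof -
  interpret P: product_prob_space "\<lambda>_::nat list. measure_pmf \<mu>" UNIV by standard
  have "AE x in measure_pmf \<mu>. \<bar>x\<bar> \<le> 2"
  proof (rule AE_pmfI)
    fix x assume "x \<in> set_pmf \<mu>"
    with assms have "x \<in> {-2..2}" by (rule subsetD)
    then show "\<bar>x\<bar> \<le> 2" by auto
  qed
  then have "AE \<eta> in tree_space \<mu>. \<bar>\<eta> []\<bar> \<le> 2"
    unfolding tree_space_def by (intro P.AE_component) auto
  from AE_branch[OF _ this, of _ \<nu>]
  have "AE g in brw_space \<nu> \<mu>. \<bar>edge_step g w\<bar> \<le> 2" for w
    by (cases "w = []") (auto simp: branch_def edge_step_def)
  then show ?thesis by (simp add: AE_all_countable)
qed

section \<open>Consequences for the two walks\<close>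

lemma steady_pair_advances:
  assumes K: "\<And>u. fst (g u) = K" "2 \<le> K"
    and line: "\<And>i t. i < 2 \<Longrightarrow> alive (steady s) K t i (branch g (i # 1 # replicate n 0))"
  shows "\<exists>m A. \<forall>t. A + 2 * s * int t \<in> occupied g x (m + t) \<and> A + s + 2 * s * int t \<in> occupied g x (m + Suc t)"
proof -
  have u: "1 # replicate n 0 \<in> particles g (Suc n)"
    using K by (auto simp: particles_eq[where K = K])
  show ?thesis
    using steady_line[OF K(1) line[of 0] _ u, of x] steady_line_odd[OF K(1) line[of 1] _ u, of x] K(2)
    by (intro exI[of _ "Suc n"] exI[of _ "position g x (1 # replicate n 0)"]) auto
qed

lemma steady_speed_two:
  assumes K: "\<And>u. fst (g u) = K" "0 < K" and le: "\<And>w. edge_step g w \<le> 2"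
    and line: "\<And>t. A + 2 * int t \<in> occupied g 1 (m + t)"
  shows "(\<lambda>n. real_of_int (rightmost g 1 n) / real n) \<longlonglongrightarrow> 2"
proof (rule speed_two)
  note fin = occupied_finite_nonempty[where K = K, OF K]
  fix n
  show "rightmost g 1 n \<le> 2 * int n + 1"
    using occupied_le[of 1 g _ 1 n] le Max_in[OF fin] by (simp add: rightmost_def add.commute)
next
  note fin = occupied_finite_nonempty[where K = K, OF K]
  fix k :: nat
  have "(int k + 1) * (2 * int n - rightmost g 1 n) \<le> int n + \<bar>(int k + 1) * (2 * int m - A)\<bar>" if "m \<le> n" for n
  proof -
    have "A + 2 * int (n - m) \<le> rightmost g 1 n"
      unfolding rightmost_def using line[of "n - m"] that by (intro Max_ge fin) simp
    then have "2 * int n - rightmost g 1 n \<le> 2 * int m - A" using that by (simp add: of_nat_diff)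
    then have "(int k + 1) * (2 * int n - rightmost g 1 n) \<le> (int k + 1) * (2 * int m - A)"
      by (intro mult_left_mono) auto
    then show ?thesis by linarith
  qed
  then show "\<exists>C N. \<forall>n\<ge>N. (int k + 1) * (2 * int n - rightmost g 1 n) \<le> int n + C" by blast
qed

lemma sparing_speed_two:
  assumes K: "\<And>u. fst (g u) = K" "2 \<le> K" and le: "\<And>w. edge_step g w \<le> 2"
    and line: "\<And>k. \<exists>n. \<forall>t. alive (sparing k) K t 0 (branch g (1 # replicate n 0))"
  shows "(\<lambda>n. real_of_int (rightmost g 0 n) / real n) \<longlonglongrightarrow> 2"
proof (rule speed_two)
  have "0 < K" using K(2) by simp
  note fin = occupied_finite_nonempty[where K = K, OF K(1) this]
  fix n
  show "rightmost g 0 n \<le> 2 * int n + 1"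
    using occupied_le[of 1 g "rightmost g 0 n" 0 n] le Max_in[OF fin] by (simp add: rightmost_def)
next
  have "0 < K" using K(2) by simp
  note fin = occupied_finite_nonempty[where K = K, OF K(1) this]
  fix k :: nat
  obtain m where m: "\<And>t. alive (sparing k) K t 0 (branch g (1 # replicate m 0))" using line by blast
  have u: "replicate m 0 \<in> particles g m" using K by (auto simp: particles_eq[where K = K])
  define A where "A = position g 0 (replicate m 0)"
  have "(int k + 1) * (2 * int n - rightmost g 0 n) \<le> int n + (int k - int m + (int k + 1) * (2 * int m - A))"
    if mn: "m \<le> n" for n
  proof -
    obtain y where y: "y \<in> occupied g 0 n" "(int k + 1) * (2 * int (n - m) - (y - A)) \<le> int (n - m) + int k"
      using sparing_line[OF K(1) m[of "n - m"] _ _ u, of 0] K(2) by (auto simp: A_def le_add_diff_inverse[OF mn])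
    have "y \<le> rightmost g 0 n" unfolding rightmost_def by (intro Max_ge fin y)
    then have "(int k + 1) * (2 * int n - rightmost g 0 n) \<le> (int k + 1) * (2 * int n - y)"
      by (intro mult_left_mono) auto
    with y(2) mn show ?thesis by (simp add: of_nat_diff algebra_simps)
  qed
  then show "\<exists>C N. \<forall>n\<ge>N. (int k + 1) * (2 * int n - rightmost g 0 n) \<le> int n + C" by blast
qed

section \<open>The two displacement laws\<close>

text \<open>
  Four children per particle, each of which takes a step \<open>2\<close> with probability 1/4: the red
  full-speed lines are critical.
\<close>

definition red_law :: "int pmf" where
  "red_law = pmf_of_set {-2, -1, 1, 2}"

text \<open>
  The law gives mass 1/17 to each of \<open>\<plusminus>1\<close> and \<open>\<plusminus>2\<close> and the remaining 13/17 to 0, so the variance is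
  small.  Large families of 34 children make the blue full-speed lines supercritical nevertheless.
\<close>

definition blue_law :: "int pmf" where
  "blue_law = map_pmf (\<lambda>x. if \<bar>x\<bar> \<le> 2 then x else 0) (pmf_of_set {-8..8})"

lemma set_red_law: "set_pmf red_law = {-2, -1, 1, 2}"
  by (simp add: red_law_def)

lemma set_blue_law: "set_pmf blue_law = {-2..2}"
proof -
  have "set_pmf blue_law = (\<lambda>x. if \<bar>x\<bar> \<le> 2 then x else 0) ` {-8..8}"
    by (simp add: blue_law_def)
  also have "\<dots> = {-2..2}" by (auto simp: image_iff intro!: bexI)
  finally show ?thesis .
qed

lemma pmf_red_law: "x \<in> {-2, -1, 1, 2} \<Longrightarrow> pmf red_law x = 1 / 4"
  by (auto simp: red_law_def)

lemma pmf_blue_law: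
  assumes "x \<noteq> 0" "\<bar>x\<bar> \<le> 2"
  shows "pmf blue_law x = 1 / 17"
proof -
  have "{-8..8} \<inter> (\<lambda>x. if \<bar>x\<bar> \<le> 2 then x else 0) -` {x} = {x}"
    using assms by (auto split: if_splits)
  then show ?thesis by (simp add: blue_law_def pmf_map measure_pmf_of_set)
qed

lemma displacement_law_red: "displacement_law 2 red_law"
proof -
  have "map_pmf uminus red_law = pmf_of_set (uminus ` {-2, -1, 1, 2})"
    unfolding red_law_def by (rule map_pmf_of_set_inj) auto
  also have "uminus ` {-2, -1, 1, 2} = {-2, -1, 1, 2 :: int}" by auto
  finally show ?thesis unfolding displacement_law_def set_red_law by (auto simp: red_law_def)
qed

lemma displacement_law_blue: "displacement_law 2 blue_law"
proof -
  have "map_pmf uminus blue_law = map_pmf (\<lambda>x. if \<bar>x\<bar> \<le> 2 then x else 0) (map_pmf uminus (pmf_of_set {-8..8}))"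
    unfolding blue_law_def map_pmf_comp by (intro map_pmf_cong) auto
  also have "map_pmf uminus (pmf_of_set {-8..8}) = pmf_of_set (uminus ` {-8..8::int})"
    by (rule map_pmf_of_set_inj) auto
  also have "uminus ` {-8..8} = {-8..8::int}" by simp
  finally show ?thesis unfolding displacement_law_def set_blue_law by (auto simp: blue_law_def)
qed

lemma variance_red_law: "measure_pmf.expectation red_law (\<lambda>x. (real_of_int x)\<^sup>2) = 5 / 2"
  by (simp add: red_law_def integral_pmf_of_set)

lemma variance_blue_law: "measure_pmf.expectation blue_law (\<lambda>x. (real_of_int x)\<^sup>2) = 10 / 17"
proof -
  have "(\<Sum>x\<in>{-8..8::int}. (real_of_int (if \<bar>x\<bar> \<le> 2 then x else 0))\<^sup>2)
      = (\<Sum>x\<in>{-2, -1, 1, 2}. (real_of_int (if \<bar>x\<bar> \<le> 2 then x else 0))\<^sup>2)"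
    by (rule sum.mono_neutral_right) (auto split: if_splits)
  then show ?thesis by (simp add: blue_law_def integral_pmf_of_set)
qed

lemma offspring_number_law_return: "2 \<le> K \<Longrightarrow> offspring_number_law (return_pmf K)"
  by (auto simp: offspring_number_law_def intro: integrable_measure_pmf_finite)

lemma AE_fst_snd:
  assumes "AE x in M. P x" "AE y in N. Q y" "prob_space M" "prob_space N"
  shows "AE \<omega> in M \<Otimes>\<^sub>M N. P (fst \<omega>) \<and> Q (snd \<omega>)"
proof -
  interpret M: prob_space M by fact
  interpret N: prob_space N by fact
  have "AE \<omega> in M \<Otimes>\<^sub>M N. P (fst \<omega>)"
    by (rule AE_distrD[OF measurable_fst, where P = P]) (unfold N.distr_pair_fst, fact)
  moreover have "distr (M \<Otimes>\<^sub>M N) N snd = N"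
  proof (rule measure_eqI)
    fix A assume A: "A \<in> sets (distr (M \<Otimes>\<^sub>M N) N snd)"
    then have "snd -` A \<inter> space (M \<Otimes>\<^sub>M N) = space M \<times> A"
      using sets.sets_into_space[of A N] by (auto simp: space_pair_measure)
    with A show "emeasure (distr (M \<Otimes>\<^sub>M N) N snd) A = emeasure N A"
      by (simp add: emeasure_distr N.emeasure_pair_measure_Times M.emeasure_space_1)
  qed simp
  then have "AE \<omega> in M \<Otimes>\<^sub>M N. Q (snd \<omega>)"
    by (intro AE_distrD[OF measurable_snd, where P = Q]) (simp only: assms(2))
  ultimately show ?thesis by simp
qed

section \<open>Blue wins almost surely\<close>

definition good_red :: "genealogy \<Rightarrow> bool" where
  "good_red g \<longleftrightarrow> (\<forall>u. fst (g u) = 4) \<and> (\<forall>w. \<bar>edge_step g w\<bar> \<le> 2) \<and>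
     (\<forall>s\<in>{-1, 1}. \<forall>w. w \<noteq> [] \<longrightarrow> (\<exists>n. \<not> alive (steady s) 4 n 0 (branch g w))) \<and>
     (\<forall>k. \<exists>n. \<forall>t. alive (sparing k) 4 t 0 (branch g (1 # replicate n 0)))"

definition good_blue :: "genealogy \<Rightarrow> bool" where
  "good_blue g \<longleftrightarrow> (\<forall>u. fst (g u) = 34) \<and> (\<forall>w. \<bar>edge_step g w\<bar> \<le> 2) \<and>
     (\<forall>s\<in>{-1, 1}. \<exists>n. \<forall>i<2. \<forall>t. alive (steady s) 34 t i (branch g (i # 1 # replicate n 0)))"

lemma AE_good_red: "AE g in brw_space (return_pmf 4) red_law. good_red g"
proof -
  have "AE g in brw_space (return_pmf 4) red_law. \<forall>w. w \<noteq> [] \<longrightarrow>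
      (\<exists>n. \<not> alive (steady s) 4 n 0 (branch g w))" if "s \<in> {-1, 1}" for s
    using that by (intro AE_no_steady) (auto simp: pmf_red_law)
  moreover have "AE g in brw_space (return_pmf 4) red_law. \<forall>w. \<bar>edge_step g w\<bar> \<le> 2"
    by (intro AE_edge_step_bounded) (auto simp: set_red_law)
  moreover have "AE g in brw_space (return_pmf 4) red_law.
      \<forall>k. \<exists>n. \<forall>t. alive (sparing k) 4 t 0 (branch g (1 # replicate n 0))"
    unfolding AE_all_countable by (intro allI AE_some_sparing) (simp_all add: pmf_red_law)
  ultimately show ?thesis
    unfolding good_red_def by (simp add: AE_offspring_number)
qed

lemma AE_good_blue: "AE g in brw_space (return_pmf 34) blue_law. good_blue g"
proof -
  have "AE g in brw_space (return_pmf 34) blue_law.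
      \<exists>n. \<forall>i<2. \<forall>t. alive (steady s) 34 t i (branch g (i # 1 # replicate n 0))" if "s \<in> {-1, 1}" for s
    using that by (intro AE_some_steady_pair) (auto simp: pmf_blue_law)
  moreover have "AE g in brw_space (return_pmf 34) blue_law. \<forall>w. \<bar>edge_step g w\<bar> \<le> 2"
    by (intro AE_edge_step_bounded) (simp add: set_blue_law)
  ultimately show ?thesis
    unfolding good_blue_def by (simp add: AE_offspring_number)
qed

text \<open>
  The race is decided separately in the directions \<open>s = 1\<close> and \<open>s = -1\<close>.
\<close>

lemma good_far_sites_first_blue:
  assumes r: "good_red gr" and b: "good_blue gb"
  shows "\<exists>Y. \<forall>y. Y \<le> \<bar>y\<bar> \<longrightarrow> first_visit gb 1 y < first_visit gr 0 y"
proof -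
  have one_side: "\<exists>Y. \<forall>y. Y \<le> s * y \<longrightarrow> first_visit gb 1 y < first_visit gr 0 y" if s: "s \<in> {-1, 1}" for s
  proof -
    have ss: "s * s = 1" using s by auto
    have le: "s * edge_step gr w \<le> 2" for w
    proof -
      have "\<bar>edge_step gr w\<bar> \<le> 2" using r by (simp add: good_red_def)
      then show ?thesis using s by auto
    qed
    obtain n where "\<And>i t. i < 2 \<Longrightarrow> alive (steady s) 34 t i (branch gb (i # 1 # replicate n 0))"
      using b s unfolding good_blue_def by blast
    then have "\<exists>m A. \<forall>t. A + 2 * s * int t \<in> occupied gb 1 (m + t) \<and>
        A + s + 2 * s * int t \<in> occupied gb 1 (m + Suc t)"
      using b by (intro steady_pair_advances[where K = 34 and n = n]) (auto simp: good_blue_def)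
    then obtain m A where blue: "\<And>t. A + 2 * s * int t \<in> occupied gb 1 (m + t)"
        "\<And>t. A + s + 2 * s * int t \<in> occupied gb 1 (m + Suc t)"
      by blast
    have far: "\<exists>N. \<forall>n\<ge>N. \<forall>y\<in>occupied gr 0 n. s * y \<le> 2 * int n - c" for c
      using r s by (intro occupied_far_behind[where K = 4] ss le) (auto simp: good_red_def)
    have "s * y \<le> 2 * int n" if "y \<in> occupied gr 0 n" for n y
      using occupied_le[OF le that] by simp
    from sites_beyond_first_blue[OF ss this far blue] show ?thesis .
  qed
  from one_side[of 1] obtain Y where Y: "\<And>y. Y \<le> y \<Longrightarrow> first_visit gb 1 y < first_visit gr 0 y" by auto
  from one_side[of "-1"] obtain Y' where Y': "\<And>y. Y' \<le> - y \<Longrightarrow> first_visit gb 1 y < first_visit gr 0 y" by auto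
  show ?thesis
  proof (intro exI[of _ "max Y Y'"] allI impI)
    fix y assume "max Y Y' \<le> \<bar>y\<bar>"
    then show "first_visit gb 1 y < first_visit gr 0 y" using Y[of y] Y'[of y] by (cases "0 \<le> y") auto
  qed
qed

lemma good_speeds:
  assumes "good_red (fst \<omega>)" "good_blue (snd \<omega>)"
  shows "(\<lambda>n. real_of_int (red_max \<omega> n) / real n) \<longlonglongrightarrow> 2"
    and "(\<lambda>n. real_of_int (blue_max \<omega> n) / real n) \<longlonglongrightarrow> 2"
proof -
  have le: "x \<le> 2" if "\<bar>x\<bar> \<le> 2" for x :: int using that by simp
  show "(\<lambda>n. real_of_int (red_max \<omega> n) / real n) \<longlonglongrightarrow> 2"
    unfolding red_max_def using assms(1) le
    by (intro sparing_speed_two[where K = 4]) (auto simp: good_red_def)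
  obtain n where "\<And>i t. i < 2 \<Longrightarrow> alive (steady 1) 34 t i (branch (snd \<omega>) (i # 1 # replicate n 0))"
    using assms(2) unfolding good_blue_def by blast
  then have "\<exists>m A. \<forall>t. A + 2 * 1 * int t \<in> occupied (snd \<omega>) 1 (m + t) \<and>
      A + 1 + 2 * 1 * int t \<in> occupied (snd \<omega>) 1 (m + Suc t)"
    using assms(2) by (intro steady_pair_advances[where K = 34 and n = n]) (auto simp: good_blue_def)
  then obtain m A where "\<And>t. A + 2 * int t \<in> occupied (snd \<omega>) 1 (m + t)"
    by auto
  then show "(\<lambda>n. real_of_int (blue_max \<omega> n) / real n) \<longlonglongrightarrow> 2"
    unfolding blue_max_def using assms(2) le
    by (intro steady_speed_two[where K = 34]) (auto simp: good_blue_def)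
qed

lemma good_colours:
  assumes "good_red (fst \<omega>)" "good_blue (snd \<omega>)"
  shows "infinite (blue_sites tie \<omega>)" "finite (red_sites tie \<omega>)"
proof -
  obtain Y where Y: "\<And>y. Y \<le> \<bar>y\<bar> \<Longrightarrow> blue_time \<omega> y < red_time \<omega> y"
    using good_far_sites_first_blue[OF assms] by (auto simp: blue_time_def red_time_def)
  have "{max 0 Y..} \<subseteq> blue_sites tie \<omega>" using Y by (auto simp: blue_sites_def)
  then show "infinite (blue_sites tie \<omega>)" using infinite_Ici infinite_super by blast
  have "red_sites tie \<omega> \<subseteq> {- Y..Y}"
  proof
    fix y assume "y \<in> red_sites tie \<omega>"
    then have "\<not> Y \<le> \<bar>y\<bar>" using Y[of y] by (auto simp: red_sites_def)
    then show "y \<in> {- Y..Y}" by auto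
  qed
  then show "finite (red_sites tie \<omega>)" by (rule finite_subset) simp
qed

theorem theorem2p9:
  "\<exists>(M :: nat) (\<nu>r :: nat pmf) (\<mu>r :: int pmf) (\<nu>b :: nat pmf) (\<mu>b :: int pmf).
     model_class M \<nu>r \<mu>r \<nu>b \<mu>b \<and>
     measure_pmf.expectation \<mu>r (\<lambda>x. (real_of_int x)\<^sup>2) >
       3 * measure_pmf.expectation \<mu>b (\<lambda>x. (real_of_int x)\<^sup>2) \<and>
     min (measure_pmf.prob \<mu>r {x. x \<notin> {-1, 0, 1}}) (measure_pmf.prob \<mu>b {x. x \<notin> {-1, 0, 1}}) > 0 \<and>
     (AE \<omega> in two_colour_space \<nu>r \<mu>r \<nu>b \<mu>b. \<exists>v :: real.
        (\<lambda>n. real_of_int (red_max \<omega> n) / real n) \<longlonglongrightarrow> v \<and>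
        (\<lambda>n. real_of_int (blue_max \<omega> n) / real n) \<longlonglongrightarrow> v) \<and>
     (\<forall>tie :: tie_rule.
        (AE \<omega> in two_colour_space \<nu>r \<mu>r \<nu>b \<mu>b. infinite (blue_sites tie \<omega>)) \<and>
        (AE \<omega> in two_colour_space \<nu>r \<mu>r \<nu>b \<mu>b. finite (red_sites tie \<omega>)))"
proof -
  let ?S = "two_colour_space (return_pmf 4) red_law (return_pmf 34) blue_law"
  have good: "AE \<omega> in ?S. good_red (fst \<omega>) \<and> good_blue (snd \<omega>)"
    unfolding two_colour_space_def
    by (intro AE_fst_snd AE_good_red AE_good_blue prob_space_brw_space)
  have model: "model_class 2 (return_pmf 4) red_law (return_pmf 34) blue_law"
    by (simp add: model_class_def offspring_number_law_return displacement_law_red displacement_law_blue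
        pmf_red_law pmf_blue_law)
  have far: "0 < measure_pmf.prob \<mu> {x. x \<notin> {-1, 0, 1}}" if "0 < pmf \<mu> 2" for \<mu> :: "int pmf"
  proof -
    have "pmf \<mu> 2 = measure_pmf.prob \<mu> {2}" by (simp add: pmf.rep_eq)
    also have "\<dots> \<le> measure_pmf.prob \<mu> {x. x \<notin> {-1, 0, 1}}"
      by (intro measure_pmf.finite_measure_mono) auto
    finally show ?thesis using that by simp
  qed
  have "AE \<omega> in ?S. \<exists>v :: real. (\<lambda>n. real_of_int (red_max \<omega> n) / real n) \<longlonglongrightarrow> v \<and>
        (\<lambda>n. real_of_int (blue_max \<omega> n) / real n) \<longlonglongrightarrow> v"
    using good by (rule eventually_mono) (use good_speeds in blast)
  moreover have "AE \<omega> in ?S. infinite (blue_sites tie \<omega>)" for tie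
    using good by (rule eventually_mono) (use good_colours in blast)
  moreover have "AE \<omega> in ?S. finite (red_sites tie \<omega>)" for tie
    using good by (rule eventually_mono) (use good_colours in blast)
  moreover have "0 < measure_pmf.prob red_law {x. x \<notin> {-1, 0, 1}}" "0 < measure_pmf.prob blue_law {x. x \<notin> {-1, 0, 1}}"
    using far[of red_law] far[of blue_law] by (simp_all add: pmf_red_law pmf_blue_law)
  ultimately show ?thesis
    using model
    by (intro exI[of _ "2::nat"] exI[of _ "return_pmf 4"] exI[of _ red_law] exI[of _ "return_pmf 34"]
          exI[of _ blue_law]) (simp add: variance_red_law variance_blue_law)
qed

end
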